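(* Let $c$ be a Coxeter element of a finite Coxeter group $W$. The $c$-sortable elements constitute a sublattice of the weak order on $W$; that is, if $x$ and $y$ are $c$-sortable then so are their meet $x\wedge y$ and their join $x\vee y$ in the weak order on $W$.
   Context: A Coxeter group $W$ comes with a fixed finite set $S$ of simple generators and presentation $(st)^{m(s,t)}=1$ for $s,t\in S$, where $m(s,s)=1$ and $m(s,t)\ge 2$ for $s\ne t$. $l(w)$ is the length of $w$ with respect to $S$; a word in $S$ of length $l(w)$ representing $w$ is reduced. $T=\{wsw^{-1}:w\in W,s\in S\}$ is the set of reflections and $I(w)=\{t\in T:l(tw)<l(w)\}$ is the inversion set. The weak order is the right weak order: $v\le w$ iff $I(v)\subseteq I(w)$; equivalently its cover relations are $w\lessdot ws$ for $s\in S$ with $l(w)<l(ws)$. For $W$ finite it is a lattice. A Coxeter element $c$ of $W$ is an element represented by a word $a_1a_2\cdots a_n$ with $S=\{a_1,\ldots,a_n\}$ and $n=|S|$. Fix such a word for $c$ and form the half-infinite word $c^\infty=a_1\cdots a_n|a_1\cdots a_n|a_1\cdots a_n|\cdots$, where the dividers "$|$" are ignored when subwords are interpreted as elements of $W$. The $c$-sorting word for $w\in W$ is the lexicographically first (as a sequence of positions in $c^\infty$) subword of $c^\infty$ that is a reduced word for $w$. It defines a sequence of subsets of $S$: the sets of letters of the $c$-sorting word occurring between adjacent dividers. The element $w$ is $c$-sortable if this sequence is weakly decreasing under inclusion; this does not depend on the choice of reduced word for $c$. *)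

theory Defs
  imports "HOL-Algebra.Lattice" "HOL-Algebra.Generated_Groups" "HOL-Library.Extended_Nat"
begin

section \<open>Group presentations\<close>

text \<open>A word in the free group on \<open>S\<close> is a list of signed letters: \<open>(s, True)\<close> stands for the
  generator \<open>s\<close> and \<open>(s, False)\<close> for its formal inverse.\<close>

definition signed_word_value :: "('a, 'b) monoid_scheme \<Rightarrow> ('a \<times> bool) list \<Rightarrow> 'a" where
  "signed_word_value G u =
     foldr (\<lambda>(s, b) g. (if b then s else inv\<^bsub>G\<^esub> s) \<otimes>\<^bsub>G\<^esub> g) u \<one>\<^bsub>G\<^esub>"

inductive_set presentation_step :: "'a set \<Rightarrow> ('a \<times> bool) list set \<Rightarrow>
    (('a \<times> bool) list \<times> ('a \<times> bool) list) set"
  for S :: "'a set" and R :: "('a \<times> bool) list set" where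
  cancel: "s \<in> S \<Longrightarrow> (u @ v, u @ [(s, b), (s, \<not> b)] @ v) \<in> presentation_step S R"
| relator: "r \<in> R \<Longrightarrow> (u @ v, u @ r @ v) \<in> presentation_step S R"

text \<open>\<open>G\<close> is the group \<open>\<langle>S | R\<rangle>\<close>: \<open>S\<close> generates \<open>G\<close>, and a word is trivial in \<open>G\<close> exactly if it
  can be transformed to the empty word by inserting and deleting relators and pairs of mutually
  inverse letters.\<close>

definition presented_by ::
  "('a, 'b) monoid_scheme \<Rightarrow> 'a set \<Rightarrow> ('a \<times> bool) list set \<Rightarrow> bool" where
  "presented_by G S R \<longleftrightarrow>
     group G \<and> S \<subseteq> carrier G \<and> generate G S = carrier G \<and>
     (\<forall>u \<in> lists (S \<times> UNIV). signed_word_value G u = \<one>\<^bsub>G\<^esub> \<longleftrightarrow>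
        (u, []) \<in> (presentation_step S R \<union> (presentation_step S R)\<inverse>)\<^sup>*)"

section \<open>Coxeter groups\<close>

text \<open>The value \<open>\<infinity>\<close> of \<open>m s t\<close> means that no relation is imposed on \<open>s\<close> and \<open>t\<close>.\<close>

definition coxeter_relators :: "'a set \<Rightarrow> ('a \<Rightarrow> 'a \<Rightarrow> enat) \<Rightarrow> ('a \<times> bool) list set" where
  "coxeter_relators S m =
     {concat (replicate k [(s, True), (t, True)]) | s t k. s \<in> S \<and> t \<in> S \<and> m s t = enat k}"

definition coxeter_system ::
  "('a, 'b) monoid_scheme \<Rightarrow> 'a set \<Rightarrow> ('a \<Rightarrow> 'a \<Rightarrow> enat) \<Rightarrow> bool" where
  "coxeter_system W S m \<longleftrightarrow>
     finite S \<and>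
     (\<forall>s \<in> S. m s s = 1) \<and>
     (\<forall>s \<in> S. \<forall>t \<in> S. s \<noteq> t \<longrightarrow> 2 \<le> m s t) \<and>
     (\<forall>s \<in> S. \<forall>t \<in> S. m s t = m t s) \<and>
     presented_by W S (coxeter_relators S m)"

definition word_value :: "('a, 'b) monoid_scheme \<Rightarrow> 'a list \<Rightarrow> 'a" where
  "word_value W u = foldr (\<otimes>\<^bsub>W\<^esub>) u \<one>\<^bsub>W\<^esub>"

definition cox_length :: "('a, 'b) monoid_scheme \<Rightarrow> 'a set \<Rightarrow> 'a \<Rightarrow> nat" where
  "cox_length W S w = (LEAST n. \<exists>u \<in> lists S. length u = n \<and> word_value W u = w)"

definition reduced_word_for :: "('a, 'b) monoid_scheme \<Rightarrow> 'a set \<Rightarrow> 'a list \<Rightarrow> 'a \<Rightarrow> bool" where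
  "reduced_word_for W S u w \<longleftrightarrow>
     u \<in> lists S \<and> word_value W u = w \<and> length u = cox_length W S w"

definition reflections :: "('a, 'b) monoid_scheme \<Rightarrow> 'a set \<Rightarrow> 'a set" where
  "reflections W S = {w \<otimes>\<^bsub>W\<^esub> s \<otimes>\<^bsub>W\<^esub> inv\<^bsub>W\<^esub> w | w s. w \<in> carrier W \<and> s \<in> S}"

definition inversion_set :: "('a, 'b) monoid_scheme \<Rightarrow> 'a set \<Rightarrow> 'a \<Rightarrow> 'a set" where
  "inversion_set W S w =
     {t \<in> reflections W S. cox_length W S (t \<otimes>\<^bsub>W\<^esub> w) < cox_length W S w}"

definition weak_order :: "('a, 'b) monoid_scheme \<Rightarrow> 'a set \<Rightarrow> 'a gorder" where
  "weak_order W S =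
     \<lparr>carrier = carrier W, eq = (=),
      le = (\<lambda>v w. inversion_set W S v \<subseteq> inversion_set W S w)\<rparr>"

section \<open>Coxeter elements and sortable elements\<close>

definition coxeter_element_word ::
  "('a, 'b) monoid_scheme \<Rightarrow> 'a set \<Rightarrow> 'a list \<Rightarrow> 'a \<Rightarrow> bool" where
  "coxeter_element_word W S a c \<longleftrightarrow> set a = S \<and> length a = card S \<and> word_value W a = c"

text \<open>Positions in the half-infinite word \<open>c\<^sup>\<infinity> = a | a | a | \<dots>\<close> are numbered from \<open>0\<close>, so that the
  \<open>k\<close>-th divided block occupies the positions \<open>i\<close> with \<open>i div length a = k\<close>. A subword is given
  by its increasing list of positions.\<close>

definition c_infinity :: "'a list \<Rightarrow> nat \<Rightarrow> 'a" where
  "c_infinity a i = a ! (i mod length a)"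

definition reduced_subword_for ::
  "('a, 'b) monoid_scheme \<Rightarrow> 'a set \<Rightarrow> 'a list \<Rightarrow> nat list \<Rightarrow> 'a \<Rightarrow> bool" where
  "reduced_subword_for W S a ps w \<longleftrightarrow>
     sorted_wrt (<) ps \<and> reduced_word_for W S (map (c_infinity a) ps) w"

definition c_sorting_word ::
  "('a, 'b) monoid_scheme \<Rightarrow> 'a set \<Rightarrow> 'a list \<Rightarrow> nat list \<Rightarrow> 'a \<Rightarrow> bool" where
  "c_sorting_word W S a ps w \<longleftrightarrow>
     reduced_subword_for W S a ps w \<and>
     (\<forall>qs. reduced_subword_for W S a qs w \<longrightarrow> qs = ps \<or> (ps, qs) \<in> lexord {(i, j). i < j})"

definition block_letters :: "'a list \<Rightarrow> nat list \<Rightarrow> nat \<Rightarrow> 'a set" where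
  "block_letters a ps k = {c_infinity a i | i. i \<in> set ps \<and> i div length a = k}"

definition c_sortable :: "('a, 'b) monoid_scheme \<Rightarrow> 'a set \<Rightarrow> 'a list \<Rightarrow> 'a \<Rightarrow> bool" where
  "c_sortable W S a w \<longleftrightarrow>
     w \<in> carrier W \<and> (\<exists>ps. c_sorting_word W S a ps w \<and> antimono (block_letters a ps))"

section \<open>Sublattices\<close>

definition sublattice :: "('a, 'b) gorder_scheme \<Rightarrow> 'a set \<Rightarrow> bool" where
  "sublattice L A \<longleftrightarrow>
     lattice L \<and> A \<subseteq> carrier L \<and>
     (\<forall>x \<in> A. \<forall>y \<in> A. x \<sqinter>\<^bsub>L\<^esub> y \<in> A \<and> x \<squnion>\<^bsub>L\<^esub> y \<in> A)"

end

theory Submission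
  imports Defs Complex_Main
begin

text \<open>
  The proof translates sortability into linear algebra. The group acts on real vectors with one
  coordinate for each simple reflection by its geometric representation. Every root has coordinates of
  one sign (\<open>ascent_nonneg\<close>), and an inversion of \<open>w\<close> amounts to a positive root that \<open>w\<^sup>-\<^sup>1\<close> makes
  negative (\<open>root_reflection\<close>). Hence the weak order is inclusion of the finite sets \<open>inv_roots w\<close>.

  A Coxeter word \<open>c\<close> defines a skew form \<open>omega c\<close> on these vectors, with value \<open>- bform s t\<close> on the
  simple roots of \<open>s\<close> and \<open>t\<close> if \<open>s\<close> precedes \<open>t\<close>. Two properties make it useful. If \<open>s\<close> is the first
  letter of \<open>c\<close>, then \<open>omega c\<close> is nonnegative between the simple root of \<open>s\<close> and any positive root,
  and it vanishes only if these are equal or orthogonal (\<open>initial_sign\<close>). And the reflection \<open>s\<close> takes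
  the form of \<open>s d\<close> to that of the rotated word \<open>d s\<close> (\<open>omega_rotate\<close>). Now call \<open>w\<close> omega-sortable if it
  has a reduced word whose inversions \<open>\<beta>\<^sub>1, \<dots>, \<beta>\<^sub>k\<close>, in the order of the word, satisfy
  \<open>omega c \<beta>\<^sub>i \<beta>\<^sub>j \<ge> 0\<close> for \<open>i < j\<close>, with equality only for orthogonal roots. These elements obey the
  recursion of sortable elements: if \<open>s \<le> w\<close>, then \<open>w\<close> is sortable for \<open>s d\<close> if and only if \<open>s w\<close> is
  sortable for \<open>d s\<close> (\<open>omega_sortable_left_mult\<close>, \<open>omega_sortable_prepend\<close>); and if not \<open>s \<le> w\<close>, then \<open>w\<close> is
  sortable for \<open>s d\<close> if and only if it is sortable for \<open>d\<close> (\<open>omega_sortable_no_descent\<close>,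
  \<open>omega_sortable_insert\<close>). Therefore they are the sortable elements (\<open>c_sortable_iff_omega_sortable\<close>).

  What is gained is that a sorted list of roots remains sorted when roots are removed. This gives two
  statements that are hard to see on sorting words. The parabolic part of a sortable element is
  sortable (\<open>omega_sortable_restrict\<close>). And if \<open>s\<close> is the last letter of \<open>c\<close> and \<open>s \<le> w\<close>, then with \<open>w\<close> also
  \<open>s w\<close> is sortable for the same word \<open>c\<close> (\<open>omega_sortable_final_left_mult\<close>).

  Both closure properties follow by induction on the length of \<open>c = s d\<close> and on lengths in the group. If
  \<open>x\<close> and \<open>y\<close> are both above \<open>s\<close>, or both not, then the recursion applies to both at once. Let
  \<open>x\<close> be above \<open>s\<close> and \<open>y\<close> not. Then \<open>y\<close> lies in the parabolic subgroup of the letters of \<open>d\<close>, and the meet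
  of \<open>x\<close> and \<open>y\<close> is the meet of \<open>y\<close> and the parabolic part of \<open>x\<close> (\<open>omega_sortable_meet\<close>). For the join it
  suffices that \<open>s \<squnion> y\<close> is sortable. An induction shows this for the word \<open>d s\<close>, in which \<open>s\<close> is last, and
  the second of the two statements carries it over to \<open>s d\<close> (\<open>omega_sortable_join\<close>). The joins
  exist because a finite group has a longest element, which bounds all others (\<open>ex_longest\<close>,
  \<open>ex_join\<close>).
\<close>

section \<open>The geometric representation\<close>

locale coxeter = group W for W :: "('a, 'b) monoid_scheme" (structure) +
  fixes S :: "'a set" and m :: "'a \<Rightarrow> 'a \<Rightarrow> enat"
  assumes system: "coxeter_system W S m"
begin

lemma finite_S: "finite S"
  and m_self: "s \<in> S \<Longrightarrow> m s s = 1"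
  and m_ge_2: "s \<in> S \<Longrightarrow> t \<in> S \<Longrightarrow> s \<noteq> t \<Longrightarrow> 2 \<le> m s t"
  and m_sym: "s \<in> S \<Longrightarrow> t \<in> S \<Longrightarrow> m s t = m t s"
  and presented: "presented_by W S (coxeter_relators S m)"
  using system unfolding coxeter_system_def by auto

lemma S_carrier: "s \<in> S \<Longrightarrow> s \<in> carrier W"
  using presented unfolding presented_by_def by auto

text \<open>The Gram matrix of the simple roots. The value \<open>- 1\<close> for \<open>m s t = \<infinity>\<close> is the limit of
  \<open>- cos (\<pi> / k)\<close>.\<close>

definition bform :: "'a \<Rightarrow> 'a \<Rightarrow> real" where
  "bform s t = (case m s t of enat k \<Rightarrow> - cos (pi / real k) | \<infinity> \<Rightarrow> - 1)"

text \<open>The inner product with the simple root of \<open>s\<close>, half of the usual coroot. Vectors are real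
  functions on the type of the group elements; no reflection changes a coordinate outside \<open>S\<close>.\<close>

definition coroot :: "'a \<Rightarrow> ('a \<Rightarrow> real) \<Rightarrow> real" where
  "coroot s x = (\<Sum>t\<in>S. bform s t * x t)"

definition reflect :: "'a \<Rightarrow> ('a \<Rightarrow> real) \<Rightarrow> 'a \<Rightarrow> real" where
  "reflect s x = x(s := x s - 2 * coroot s x)"

definition simple_root :: "'a \<Rightarrow> 'a \<Rightarrow> real" where
  "simple_root s = (\<lambda>t. if t = s then 1 else 0)"

abbreviation act_word :: "'a list \<Rightarrow> ('a \<Rightarrow> real) \<Rightarrow> 'a \<Rightarrow> real" where
  "act_word u x \<equiv> foldr reflect u x"

definition comb :: "real \<Rightarrow> 'a \<Rightarrow> real \<Rightarrow> 'a \<Rightarrow> 'a \<Rightarrow> real" where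
  "comb p s q t = (\<lambda>x. p * simple_root s x + q * simple_root t x)"

lemma bform_self: "s \<in> S \<Longrightarrow> bform s s = 1"
  by (simp add: bform_def m_self one_enat_def)

lemma bform_sym: "s \<in> S \<Longrightarrow> t \<in> S \<Longrightarrow> bform s t = bform t s"
  by (simp add: bform_def m_sym)

lemma bform_nonpos:
  assumes "s \<in> S" "t \<in> S" "s \<noteq> t"
  shows "bform s t \<le> 0"
proof (cases "m s t")
  case (enat k)
  have "2 \<le> k" using m_ge_2[OF assms] enat by (simp add: numeral_eq_enat)
  then have "pi / real k \<le> pi / 2" by (intro divide_left_mono) auto
  then have "0 \<le> cos (pi / real k)" by (intro cos_ge_zero) (auto intro: order_trans[of _ 0])
  then show ?thesis by (simp add: bform_def enat)
qed (simp add: bform_def)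

lemma coroot_add: "coroot s (\<lambda>t. x t + y t) = coroot s x + coroot s y"
  by (simp add: coroot_def distrib_left sum.distrib)

lemma coroot_scale: "coroot s (\<lambda>t. p * x t) = p * coroot s x"
  by (simp add: coroot_def sum_distrib_left algebra_simps)

lemma coroot_simple_root: "t \<in> S \<Longrightarrow> coroot s (simple_root t) = bform s t"
  using finite_S by (simp add: coroot_def simple_root_def if_distrib cong: if_cong)

lemma coroot_comb: "s \<in> S \<Longrightarrow> t \<in> S \<Longrightarrow> coroot r (comb p s q t) = p * bform r s + q * bform r t"
  unfolding comb_def by (simp add: coroot_add coroot_scale coroot_simple_root)

lemma reflect_add: "reflect s (\<lambda>t. x t + y t) = (\<lambda>t. reflect s x t + reflect s y t)"
  by (auto simp: reflect_def coroot_add)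

lemma reflect_scale: "reflect s (\<lambda>t. p * x t) = (\<lambda>t. p * reflect s x t)"
  by (auto simp: reflect_def coroot_scale algebra_simps)

lemma act_word_add: "act_word u (\<lambda>t. x t + y t) = (\<lambda>t. act_word u x t + act_word u y t)"
  by (induction u) (simp_all add: reflect_add)

lemma act_word_scale: "act_word u (\<lambda>t. p * x t) = (\<lambda>t. p * act_word u x t)"
  by (induction u) (simp_all add: reflect_scale)

lemma reflect_fix: "coroot s x = 0 \<Longrightarrow> reflect s x = x"
  by (simp add: reflect_def)

lemma coroot_reflect: "s \<in> S \<Longrightarrow> coroot r (reflect s x) = coroot r x - 2 * coroot s x * bform r s"
proof -
  assume s: "s \<in> S"
  have "reflect s x = (\<lambda>t. x t + (- 2 * coroot s x) * simple_root s t)"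
    by (auto simp: reflect_def simple_root_def)
  then show ?thesis
    using coroot_add[of r x "\<lambda>t. (- 2 * coroot s x) * simple_root s t"]
      coroot_scale[of r "- 2 * coroot s x" "simple_root s"] coroot_simple_root[OF s, of r]
    by simp
qed

lemma reflect_reflect: "s \<in> S \<Longrightarrow> reflect s (reflect s x) = x"
  by (rule ext) (simp add: reflect_def[of s "reflect s x"] coroot_reflect bform_self, simp add: reflect_def)

lemma reflect_comb_left:
  assumes "s \<in> S" "t \<in> S" "s \<noteq> t"
  shows "reflect s (comb p s q t) = comb (2 * (- bform s t) * q - p) s q t"
  using assms by (auto simp: reflect_def coroot_comb bform_self) (auto simp: comb_def simple_root_def)

lemma comb_commute: "comb p s q t = comb q t p s"
  by (auto simp: comb_def)

lemma reflect_comb_right: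
  assumes "s \<in> S" "t \<in> S" "s \<noteq> t"
  shows "reflect t (comb p s q t) = comb p s (2 * (- bform s t) * p - q) t"
  using reflect_comb_left[of t s q p] assms by (simp add: comb_commute bform_sym)

text \<open>The alternating word of length \<open>k\<close> with last letter \<open>t\<close>. It grows on the left, the side from
  which further letters act on a root.\<close>

fun alt_word :: "'a \<Rightarrow> 'a \<Rightarrow> nat \<Rightarrow> 'a list" where
  "alt_word s t 0 = []"
| "alt_word s t (Suc k) = (if even k then t else s) # alt_word s t k"

text \<open>The Chebyshev polynomial \<open>U\<^bsub>k-1\<^esub>\<close> at \<open>- bform s t\<close>, in closed form.\<close>

definition dihedral_coeff :: "'a \<Rightarrow> 'a \<Rightarrow> nat \<Rightarrow> real" where
  "dihedral_coeff s t k =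
     (case m s t of enat n \<Rightarrow> sin (real k * (pi / real n)) / sin (pi / real n) | \<infinity> \<Rightarrow> real k)"

lemma sin_pi_over_pos: "2 \<le> n \<Longrightarrow> 0 < sin (pi / real n)"
  by (rule sin_gt_zero) (auto simp: field_simps)

lemma dihedral_coeff_0: "dihedral_coeff s t 0 = 0"
  by (simp add: dihedral_coeff_def split: enat.split)

lemma dihedral_coeff_1:
  assumes "s \<in> S" "t \<in> S" "s \<noteq> t"
  shows "dihedral_coeff s t (Suc 0) = 1"
proof (cases "m s t")
  case (enat n)
  then have "2 \<le> n" using m_ge_2[OF assms] by (simp add: numeral_eq_enat)
  then show ?thesis using sin_pi_over_pos[of n] enat by (simp add: dihedral_coeff_def)
qed (simp add: dihedral_coeff_def)

lemma dihedral_coeff_rec: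
  "dihedral_coeff s t (Suc (Suc k)) = 2 * (- bform s t) * dihedral_coeff s t (Suc k) - dihedral_coeff s t k"
proof (cases "m s t")
  case (enat n)
  define a where "a = pi / real n"
  have "sin (real (Suc (Suc k)) * a) = sin (real (Suc k) * a + a)"
    and "sin (real k * a) = sin (real (Suc k) * a - a)"
    by (simp_all add: algebra_simps)
  then have "sin (real (Suc (Suc k)) * a) = 2 * cos a * sin (real (Suc k) * a) - sin (real k * a)"
    by (simp only: sin_add sin_diff) (simp add: mult.commute)
  then show ?thesis
    unfolding dihedral_coeff_def bform_def enat enat.simps a_def[symmetric]
    by (simp only: diff_divide_distrib minus_minus times_divide_eq_right)
qed (simp add: dihedral_coeff_def bform_def)

text \<open>Each new letter turns a pair of consecutive Chebyshev values into the next pair. The closed form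
  of these values then gives both the relations between the reflections and the signs of the
  coefficients.\<close>

lemma act_alt_word:
  assumes "s \<in> S" "t \<in> S" "s \<noteq> t"
  shows "act_word (alt_word s t k) (simple_root s) =
    (if even k then comb (dihedral_coeff s t (Suc k)) s (dihedral_coeff s t k) t
     else comb (dihedral_coeff s t k) s (dihedral_coeff s t (Suc k)) t)"
proof (induction k)
  case 0
  show ?case by (simp add: dihedral_coeff_0 dihedral_coeff_1[OF assms] comb_def)
next
  case (Suc k)
  then show ?case
    by (auto simp: reflect_comb_left[OF assms] reflect_comb_right[OF assms] dihedral_coeff_rec)
qed

lemma dihedral_coeff_nonneg:
  assumes "s \<in> S" "t \<in> S" "s \<noteq> t" "enat k \<le> m s t"
  shows "0 \<le> dihedral_coeff s t k"
proof (cases "m s t")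
  case (enat n)
  then have n: "2 \<le> n" using m_ge_2[OF assms(1-3)] by (simp add: numeral_eq_enat)
  have "k \<le> n" using assms(4) enat by simp
  then have "real k * (pi / real n) \<le> pi" using n by (simp add: field_simps)
  then have "0 \<le> sin (real k * (pi / real n))" by (intro sin_ge_zero) auto
  then show ?thesis using sin_pi_over_pos[OF n] enat by (simp add: dihedral_coeff_def)
qed (simp add: dihedral_coeff_def)

lemma alt_word_even: "alt_word s t (2 * k) = concat (replicate k [s, t])"
  by (induction k) auto

lemma act_word_scaled_sum:
  "act_word u (comb p s q t) = (\<lambda>x. p * act_word u (simple_root s) x + q * act_word u (simple_root t) x)"
  unfolding comb_def by (simp add: act_word_add act_word_scale)

lemma alt_word_snoc: "alt_word s t (Suc k) = alt_word t s k @ [t]"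
  by (induction k) auto

text \<open>On the plane of the two simple roots the word is a rotation by \<open>2 \<pi>\<close>. Since the form is
  nondegenerate on this plane, every vector is the sum of a vector of the plane and one that both
  reflections fix.\<close>

lemma act_braid_relator:
  assumes st: "s \<in> S" "t \<in> S" "s \<noteq> t" and mst: "m s t = enat n"
  shows "act_word (alt_word s t (2 * n)) x = x"
proof -
  let ?u = "alt_word s t (2 * n)"
  have n: "2 \<le> n" using m_ge_2[OF st] mst by (simp add: numeral_eq_enat)
  have mts: "m t s = enat n" using mst m_sym st by simp
  define a where "a = pi / real n"
  have sa: "0 < sin a" using sin_pi_over_pos[OF n] by (simp add: a_def)
  have na: "real n * a = pi" using n by (simp add: a_def)
  have e1: "real (Suc (2 * n)) * a = a + 2 * pi" "2 * real n * a = 2 * pi"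
    using na by (simp_all add: algebra_simps)
  have s0: "sin (2 * real n * a) = 0"
    unfolding e1(2) by (rule sin_two_pi)
  have e2: "real (2 * n - 1) * a = 2 * pi - a"
    using na n by (simp add: of_nat_diff algebra_simps)
  have U: "dihedral_coeff s t (Suc (2 * n)) = 1" "dihedral_coeff s t (2 * n) = 0"
    "dihedral_coeff t s (2 * n) = 0" "dihedral_coeff t s (2 * n - 1) = - 1"
    using sa e1(1) e2 s0 by (simp_all add: dihedral_coeff_def mst mts a_def[symmetric] sin_diff)
  have s_fix: "act_word ?u (simple_root s) = simple_root s"
    using act_alt_word[OF st, of "2 * n"] U by (simp add: comb_def)
  define k where "k = 2 * n - 1"
  have k: "2 * n = Suc k" "odd k" using n by (auto simp: k_def)
  have "reflect t (simple_root t) = (\<lambda>x. (- 1) * simple_root t x)"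
    using st unfolding reflect_def coroot_simple_root[OF st(2)] by (auto simp: bform_self simple_root_def)
  then have "act_word ?u (simple_root t) = act_word (alt_word t s k) (\<lambda>x. (- 1) * simple_root t x)"
    unfolding k(1) alt_word_snoc by (simp del: alt_word.simps)
  also have "\<dots> = (\<lambda>x. (- 1) * act_word (alt_word t s k) (simple_root t) x)"
    by (rule act_word_scale)
  also have "\<dots> = simple_root t"
  proof -
    have U': "dihedral_coeff t s k = - 1" "dihedral_coeff t s (Suc k) = 0"
      using U unfolding k(1)[symmetric] by (simp_all add: k_def)
    show ?thesis using act_alt_word[OF st(2,1) st(3)[symmetric], of k] U' k(2)
      by (simp add: comb_def)
  qed
  finally have t_fix: "act_word ?u (simple_root t) = simple_root t" .
  define b where "b = bform s t"
  have "0 \<le> cos a" "cos a < 1"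
    using bform_nonpos[OF st] sa n cos_monotone_0_pi[of 0 a] 
    by (auto simp: bform_def mst a_def[symmetric]) (auto simp: a_def field_simps)
  then have b: "b * b < 1" "b = - cos a"
    using mult_strict_mono[of "cos a" 1 "cos a" 1] by (auto simp: b_def bform_def mst a_def)
  \<comment> \<open>\<open>p\<close> and \<open>q\<close> solve the linear system that makes \<open>z\<close> orthogonal to both simple roots.\<close>
  define p where "p = (coroot s x - b * coroot t x) / (1 - b * b)"
  define q where "q = (coroot t x - b * coroot s x) / (1 - b * b)"
  define z where "z = (\<lambda>r. x r + (- 1) * comb p s q t r)"
  have pq: "p + b * q = coroot s x" "b * p + q = coroot t x"
  proof -
    have d: "1 - b * b \<noteq> 0" using b(1) by simp
    then have pq': "p * (1 - b * b) = coroot s x - b * coroot t x"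
      "q * (1 - b * b) = coroot t x - b * coroot s x"
      by (simp_all add: p_def q_def)
    have "(p + b * q) * (1 - b * b) = p * (1 - b * b) + b * (q * (1 - b * b))"
      "(b * p + q) * (1 - b * b) = b * (p * (1 - b * b)) + q * (1 - b * b)"
      by (simp_all only: distrib_right mult.assoc)
    then have "(p + b * q) * (1 - b * b) = coroot s x * (1 - b * b)"
      "(b * p + q) * (1 - b * b) = coroot t x * (1 - b * b)"
      unfolding pq' by (simp_all add: algebra_simps)
    then show "p + b * q = coroot s x" "b * p + q = coroot t x" using d by simp_all
  qed
  have z0: "coroot s z = 0" "coroot t z = 0"
    unfolding z_def coroot_add coroot_scale coroot_comb[OF st(1,2)]
    using pq bform_sym[OF st(1,2)] st by (simp_all add: bform_self b_def algebra_simps)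
  have "act_word (alt_word s t j) z = z" for j
    by (induction j) (simp_all add: reflect_fix z0)
  moreover have "act_word ?u (comb p s q t) = comb p s q t"
    by (simp add: act_word_scaled_sum s_fix t_fix) (simp add: comb_def)
  moreover have "x = (\<lambda>r. z r + comb p s q t r)" by (auto simp: z_def)
  ultimately show ?thesis using act_word_add[of ?u z "comb p s q t"] by simp
qed


section \<open>Words, length and the action of the group\<close>

abbreviation val :: "'a list \<Rightarrow> 'a" where "val \<equiv> word_value W"
abbreviation len :: "'a \<Rightarrow> nat" where "len \<equiv> cox_length W S"

declare in_lists_conv_set [simp]

lemma val_Nil [simp]: "val [] = \<one>" and val_Cons [simp]: "val (s # u) = s \<otimes> val u"
  by (simp_all add: word_value_def)

lemma val_closed [simp, intro]: "u \<in> lists S \<Longrightarrow> val u \<in> carrier W"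
  by (induction u) (auto simp: S_carrier)

lemma val_append: "u \<in> lists S \<Longrightarrow> v \<in> lists S \<Longrightarrow> val (u @ v) = val u \<otimes> val v"
  by (induction u) (auto simp: S_carrier m_assoc)

abbreviation signed :: "'a list \<Rightarrow> ('a \<times> bool) list" where
  "signed u \<equiv> map (\<lambda>s. (s, True)) u"

lemma signed_word_value_signed: "signed_word_value W (signed u) = val u"
  by (induction u) (auto simp: signed_word_value_def word_value_def)

lemma signed_relator: "concat (replicate k [(s, True), (t, True)]) = signed (concat (replicate k [s, t]))"
  by (induction k) auto

lemma act_signed: "foldr (\<lambda>(s, b). reflect s) (signed u) = foldr reflect u"
  by (induction u) auto

text \<open>The defining relators act trivially and have even length, so inserting them changes neither the
  action of a word nor the parity of its length.\<close>

lemma presentation_step_invariant: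
  assumes "(u, v) \<in> presentation_step S (coxeter_relators S m)"
  shows "foldr (\<lambda>(s, b). reflect s) u = foldr (\<lambda>(s, b). reflect s) v \<and> even (length u) = even (length v)"
  using assms
proof cases
  case (cancel s u' v' b)
  then show ?thesis by (auto simp: fun_eq_iff reflect_reflect)
next
  case (relator r u' v')
  then obtain s t k where r: "r = signed (concat (replicate k [s, t]))" "s \<in> S" "t \<in> S" "m s t = enat k"
    by (auto simp: coxeter_relators_def signed_relator)
  have id: "act_word (concat (replicate k [s, t])) x = x" for x
  proof (cases "s = t")
    case True
    then have "k = 1" using m_self r by (simp add: one_enat_def)
    then show ?thesis using True r by (simp add: reflect_reflect)
  next
    case False
    then show ?thesis using act_braid_relator[OF r(2,3) False r(4)] by (simp add: alt_word_even)
  qed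
  have "even (length r)" unfolding r by (induction k) auto
  moreover have "foldr (\<lambda>(s, b). reflect s) r = id"
    unfolding r(1) act_signed by (rule ext) (simp add: id)
  ultimately show ?thesis unfolding relator(1,2) by (intro conjI ext) simp_all
qed

text \<open>The presentation is used through this lemma and through the triviality of its relators: whatever
  is invariant under the elementary steps is the same for all words with the same value.\<close>

lemma trivial_word:
  assumes "u \<in> lists S" "val u = \<one>"
  shows "act_word u x = x" "even (length u)"
proof -
  let ?R = "presentation_step S (coxeter_relators S m)"
  have "signed u \<in> lists (S \<times> UNIV)" using assms(1) by auto
  then have "(signed u, []) \<in> (?R \<union> ?R\<inverse>)\<^sup>*"
    using presented assms(2) unfolding presented_by_def signed_word_value_signed[symmetric] by blast
  then have "foldr (\<lambda>(s, b). reflect s) (signed u) = foldr (\<lambda>(s, b). reflect s) [] \<and>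
      even (length (signed u)) = even (length ([] :: ('a \<times> bool) list))"
    by (induction rule: converse_rtrancl_induct) (auto dest: presentation_step_invariant)
  then show "act_word u x = x" "even (length u)" by (simp_all add: act_signed)
qed

lemma val_relator:
  assumes "s \<in> S" "t \<in> S" "m s t = enat k"
  shows "val (concat (replicate k [s, t])) = \<one>"
proof -
  let ?R = "presentation_step S (coxeter_relators S m)"
  let ?u = "concat (replicate k [s, t])"
  have "signed ?u \<in> coxeter_relators S m"
    unfolding coxeter_relators_def signed_relator using assms by blast
  from presentation_step.relator[OF this, of "[]" "[]" S]
  have "([], signed ?u) \<in> ?R" by simp
  then have "(signed ?u, []) \<in> (?R \<union> ?R\<inverse>)\<^sup>*" by auto
  moreover have "signed ?u \<in> lists (S \<times> UNIV)" using assms by auto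
  ultimately have "signed_word_value W (signed ?u) = \<one>"
    using presented unfolding presented_by_def by blast
  then show ?thesis unfolding signed_word_value_signed .
qed

lemma S_square: "s \<in> S \<Longrightarrow> s \<otimes> s = \<one>"
  using val_relator[of s s 1] by (simp add: m_self one_enat_def S_carrier)

lemma S_inv: "s \<in> S \<Longrightarrow> inv s = s"
  using S_square S_carrier by (simp add: inv_equality)

lemma S_cancel [simp]:
  "s \<in> S \<Longrightarrow> w \<in> carrier W \<Longrightarrow> s \<otimes> (s \<otimes> w) = w"
  "s \<in> S \<Longrightarrow> w \<in> carrier W \<Longrightarrow> w \<otimes> s \<otimes> s = w"
  by (simp_all add: m_assoc[symmetric] S_carrier S_square) (simp add: m_assoc S_carrier S_square)

lemma val_rev: "u \<in> lists S \<Longrightarrow> val (rev u) = inv (val u)"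
  by (induction u) (auto simp: val_append S_carrier inv_mult_group S_inv)

lemma ex_word: "w \<in> carrier W \<Longrightarrow> \<exists>u \<in> lists S. val u = w"
proof -
  assume "w \<in> carrier W"
  then have "w \<in> generate W S" using presented by (simp add: presented_by_def)
  then show ?thesis
  proof induction
    case one
    then show ?case by (intro bexI[of _ "[]"]) auto
  next
    case (incl h)
    then show ?case by (intro bexI[of _ "[h]"]) (auto simp: S_carrier)
  next
    case (inv h)
    then show ?case by (intro bexI[of _ "[h]"]) (auto simp: S_carrier S_inv)
  next
    case (eng h1 h2)
    then obtain u1 u2 where "u1 \<in> lists S" "u2 \<in> lists S" "val u1 = h1" "val u2 = h2" by blast
    then show ?case by (intro bexI[of _ "u1 @ u2"]) (auto simp: val_append)
  qed
qed

lemma act_word_rev: "u \<in> lists S \<Longrightarrow> act_word (rev u) (act_word u x) = x"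
  by (induction u arbitrary: x) (auto simp: reflect_reflect)

lemma same_value:
  assumes "u \<in> lists S" "v \<in> lists S" "val u = val v"
  shows "act_word u x = act_word v x" "even (length u) = even (length v)"
proof -
  have uv: "u @ rev v \<in> lists S" "val (u @ rev v) = \<one>"
    using assms by (auto simp: val_append val_rev)
  show "even (length u) = even (length v)" using trivial_word(2)[OF uv] by simp
  show "act_word u x = act_word v x"
    using trivial_word(1)[OF uv, of "act_word v x"] act_word_rev[OF assms(2)] by simp
qed

text \<open>By \<open>same_value\<close> the choice of the word is immaterial.\<close>

definition act :: "'a \<Rightarrow> ('a \<Rightarrow> real) \<Rightarrow> 'a \<Rightarrow> real" where
  "act w = foldr reflect (SOME u. u \<in> lists S \<and> val u = w)"

lemma act_val: "u \<in> lists S \<Longrightarrow> act (val u) x = act_word u x"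
proof -
  assume u: "u \<in> lists S"
  let ?v = "SOME v. v \<in> lists S \<and> val v = val u"
  have "?v \<in> lists S \<and> val ?v = val u" by (rule someI[of _ u]) (use u in auto)
  then show ?thesis unfolding act_def using u same_value by blast
qed

lemma act_one [simp]: "act \<one> x = x"
  using act_val[of "[]"] by simp

lemma act_mult: "v \<in> carrier W \<Longrightarrow> w \<in> carrier W \<Longrightarrow> act (v \<otimes> w) x = act v (act w x)"
proof -
  assume "v \<in> carrier W" "w \<in> carrier W"
  then obtain u u' where "u \<in> lists S" "val u = v" "u' \<in> lists S" "val u' = w"
    using ex_word by metis
  moreover from this have "act (val (u @ u')) x = act_word (u @ u') x" by (intro act_val) auto
  ultimately show ?thesis by (auto simp: val_append act_val)
qed

lemma act_S: "s \<in> S \<Longrightarrow> act s x = reflect s x"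
  using act_val[of "[s]"] by (simp add: S_carrier)

lemma act_inv [simp]: "w \<in> carrier W \<Longrightarrow> act (inv w) (act w x) = x" "w \<in> carrier W \<Longrightarrow> act w (act (inv w) x) = x"
  by (simp_all add: act_mult[symmetric])

lemma act_add: "w \<in> carrier W \<Longrightarrow> act w (\<lambda>t. x t + y t) = (\<lambda>t. act w x t + act w y t)"
  using ex_word[of w] by (auto simp: act_val act_word_add)

lemma act_scale: "w \<in> carrier W \<Longrightarrow> act w (\<lambda>t. p * x t) = (\<lambda>t. p * act w x t)"
  using ex_word[of w] by (auto simp: act_val act_word_scale)

lemma act_uminus: "w \<in> carrier W \<Longrightarrow> act w (\<lambda>t. - x t) = (\<lambda>t. - act w x t)"
  using act_scale[of w "-1" x] by simp

lemma act_zero: "w \<in> carrier W \<Longrightarrow> act w (\<lambda>t. 0) = (\<lambda>t. 0)"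
  using act_scale[of w 0 "\<lambda>t. 0"] by simp

definition reduced :: "'a list \<Rightarrow> bool" where
  "reduced u \<longleftrightarrow> u \<in> lists S \<and> length u = len (val u)"

lemma len_le: "u \<in> lists S \<Longrightarrow> len (val u) \<le> length u"
  unfolding cox_length_def by (rule Least_le) auto

lemma ex_reduced: "w \<in> carrier W \<Longrightarrow> \<exists>u. reduced u \<and> val u = w"
proof -
  assume "w \<in> carrier W"
  then have "\<exists>n. \<exists>u\<in>lists S. length u = n \<and> val u = w" using ex_word by blast
  from LeastI_ex[OF this] show ?thesis unfolding reduced_def cox_length_def[of W S w, symmetric]
    by blast
qed

lemma reducedD: "reduced u \<Longrightarrow> u \<in> lists S" "reduced u \<Longrightarrow> len (val u) = length u"
  by (auto simp: reduced_def)

lemma len_one [simp]: "len \<one> = 0"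
  using len_le[of "[]"] by simp

lemma len_0_iff: "w \<in> carrier W \<Longrightarrow> len w = 0 \<longleftrightarrow> w = \<one>"
  using ex_reduced[of w] by (auto simp: reduced_def)

lemma len_mult_le: "v \<in> carrier W \<Longrightarrow> w \<in> carrier W \<Longrightarrow> len (v \<otimes> w) \<le> len v + len w"
proof -
  assume "v \<in> carrier W" "w \<in> carrier W"
  then obtain u u' where "reduced u" "val u = v" "reduced u'" "val u' = w" using ex_reduced by metis
  then show ?thesis using len_le[of "u @ u'"] by (auto simp: val_append reduced_def)
qed

lemma len_inv: "w \<in> carrier W \<Longrightarrow> len (inv w) = len w"
proof -
  have le: "len (inv w) \<le> len w" if wc: "w \<in> carrier W" for w
  proof -
    obtain u where u: "reduced u" "val u = w" using ex_reduced[OF wc] by blast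
    then have "u \<in> lists S" by (simp add: reduced_def)
    then show ?thesis using u len_le[of "rev u"] val_rev[of u] by (auto simp: reduced_def)
  qed
  assume w: "w \<in> carrier W"
  then show ?thesis using le[OF w] le[of "inv w"] by simp
qed

text \<open>The lengths differ by at most one, and they differ because parities of word lengths are
  determined by the group element.\<close>

lemma len_S_mult: "s \<in> S \<Longrightarrow> w \<in> carrier W \<Longrightarrow> len (s \<otimes> w) = Suc (len w) \<or> len w = Suc (len (s \<otimes> w))"
proof -
  assume s: "s \<in> S" and w: "w \<in> carrier W"
  have le: "len (s \<otimes> w) \<le> Suc (len w)" if wc: "w \<in> carrier W" for w
  proof -
    obtain u where u: "reduced u" "val u = w" using ex_reduced[OF wc] by blast
    then show ?thesis using len_le[of "s # u"] s by (auto simp: reduced_def)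
  qed
  obtain u where u: "reduced u" "val u = w" using ex_reduced[OF w] by blast
  obtain v where v: "reduced v" "val v = s \<otimes> w" using ex_reduced[of "s \<otimes> w"] s w S_carrier by blast
  have "even (length (s # u)) = even (length v)"
    by (rule same_value(2)) (use u v s in \<open>auto simp: reduced_def\<close>)
  then have "len (s \<otimes> w) \<noteq> len w" using u v by (auto simp: reduced_def)
  moreover have "len w \<le> Suc (len (s \<otimes> w))" using le[of "s \<otimes> w"] s w S_carrier by simp
  ultimately show ?thesis using le[OF w] by linarith
qed

lemma len_mult_S: "s \<in> S \<Longrightarrow> w \<in> carrier W \<Longrightarrow> len (w \<otimes> s) = Suc (len w) \<or> len w = Suc (len (w \<otimes> s))"
  using len_S_mult[of s "inv w"] len_inv[of "w \<otimes> s"] len_inv[of w]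
  by (simp add: inv_mult_group S_carrier S_inv)

lemma reduced_append:
  assumes "reduced (u @ v)"
  shows "reduced u" "reduced v"
proof -
  have uv: "u \<in> lists S" "v \<in> lists S" using assms by (auto simp: reduced_def)
  have "length u + length v = len (val u \<otimes> val v)"
    using assms uv by (simp add: reduced_def val_append)
  also have "\<dots> \<le> len (val u) + len (val v)" using uv by (intro len_mult_le) auto
  finally show "reduced u" "reduced v"
    using len_le[OF uv(1)] len_le[OF uv(2)] uv by (auto simp: reduced_def)
qed

lemma not_reduced_repeat: "\<not> reduced (u @ [s, s] @ v)"
proof
  assume "reduced (u @ [s, s] @ v)"
  then have "reduced ([s, s] @ v)" by (rule reduced_append)
  then have "reduced [s, s]" by (rule reduced_append)
  then show False using S_square[of s] S_carrier[of s] by (auto simp: reduced_def)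
qed


section \<open>The sign of a root\<close>

abbreviation nonneg :: "('a \<Rightarrow> real) \<Rightarrow> bool" where "nonneg x \<equiv> \<forall>t. 0 \<le> x t"
abbreviation nonpos :: "('a \<Rightarrow> real) \<Rightarrow> bool" where "nonpos x \<equiv> \<forall>t. x t \<le> 0"

lemma reduced_snoc_alternating:
  assumes "reduced (p @ [s])" "set p \<subseteq> {s, t}"
  shows "p = alt_word s t (length p)"
  using assms
proof (induction p)
  case (Cons r p)
  have "reduced (p @ [s])" using reduced_append(2)[of "[r]" "p @ [s]"] Cons.prems(1) by simp
  then have p: "p = alt_word s t (length p)" using Cons by simp
  have r: "r = s \<or> r = t" using Cons.prems by auto
  show ?case
  proof (cases p)
    case Nil
    then have "r \<noteq> s" using not_reduced_repeat[of "[]" s "[]"] Cons.prems by auto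
    then show ?thesis using Nil r by simp
  next
    case (Cons q p')
    then have q: "q = (if even (length p') then t else s)" using p by simp
    have "r \<noteq> q" using not_reduced_repeat[of "[]" r "p' @ [s]"] \<open>reduced ((r # p) @ [s])\<close> Cons by auto
    then have "r = (if even (length p) then t else s)" using q r Cons by (auto split: if_splits)
    then show ?thesis using p by simp
  qed
qed simp

lemma alt_word_letters: "set (alt_word s t k) \<subseteq> {s, t}"
  by (induction k) auto

lemma length_alt_word [simp]: "length (alt_word s t k) = k"
  by (induction k) auto

lemma alt_word_suffix: "\<exists>q. alt_word s t (i + j) = q @ alt_word s t j \<and> length q = i \<and> set q \<subseteq> {s, t}"
proof (induction i)
  case (Suc i)
  then obtain q where "alt_word s t (i + j) = q @ alt_word s t j" "length q = i" "set q \<subseteq> {s, t}" by blast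
  then show ?case by (intro exI[of _ "(if even (i + j) then t else s) # q"]) auto
qed simp

text \<open>By the relation for \<open>s\<close> and \<open>t\<close>, an alternating word of length \<open>m s t + 1\<close> has the same value as
  a word of length \<open>m s t - 1\<close>.\<close>

lemma reduced_alternating_length:
  assumes st: "s \<in> S" "t \<in> S" "s \<noteq> t" and red: "reduced (alt_word s t k @ [s])"
  shows "enat (Suc k) \<le> m s t"
proof (cases "m s t")
  case (enat n)
  show ?thesis
  proof (rule ccontr)
    assume "\<not> ?thesis"
    then have "n \<le> k" using enat by simp
    then obtain q where q: "alt_word s t k = q @ alt_word s t n" "length q = k - n"
      using alt_word_suffix[of s t "k - n" n] by auto
    have n: "2 \<le> n" using m_ge_2[OF st] enat by (simp add: numeral_eq_enat)
    have red': "reduced (alt_word t s (Suc n))"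
      using red reduced_append(2)[of q "alt_word s t n @ [s]"] unfolding q alt_word_snoc by simp
    obtain r where r: "alt_word t s ((n - 1) + Suc n) = r @ alt_word t s (Suc n)" "length r = n - 1"
      "set r \<subseteq> {t, s}"
      using alt_word_suffix by metis
    have rS: "r \<in> lists S" "alt_word t s (Suc n) \<in> lists S"
      using r st alt_word_letters[of t s "Suc n"] by (auto simp del: alt_word.simps)
    have "m t s = enat n" using enat m_sym st by simp
    then have "val (alt_word t s (2 * n)) = \<one>"
      using val_relator[OF st(2,1)] by (simp add: alt_word_even)
    moreover have "2 * n = (n - 1) + Suc n" using n by simp
    ultimately have "val r \<otimes> val (alt_word t s (Suc n)) = \<one>"
      using r rS by (simp add: val_append del: alt_word.simps)
    then have "val (alt_word t s (Suc n)) = inv (val r)"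
      using rS by (metis inv_equality inv_inv val_closed)
    then have "len (val (alt_word t s (Suc n))) = len (val r)"
      using rS len_inv by simp
    then show False
      using red' len_le[OF rS(1)] r(2) n unfolding reduced_def length_alt_word by (simp del: alt_word.simps)
  qed
qed simp

lemma nonneg_simple_root: "nonneg (simple_root s)"
  by (simp add: simple_root_def)

text \<open>The induction is on the length of \<open>w\<close>. Let \<open>t\<close> be the last letter of a reduced word for \<open>w\<close>, and
  write \<open>w = v p\<close> with \<open>p\<close> a word in \<open>s\<close> and \<open>t\<close>, without loss of length and with \<open>v\<close> as short as
  possible. Then \<open>v\<close> sends the simple roots of \<open>s\<close> and \<open>t\<close> to nonnegative vectors by induction.
  The word \<open>p s\<close> is reduced, hence alternating of length at most \<open>m s t\<close>, so that \<open>p\<close> sends the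
  simple root of \<open>s\<close> to a nonnegative combination of the two.\<close>

theorem ascent_nonneg:
  assumes "w \<in> carrier W" "s \<in> S" "len (w \<otimes> s) = Suc (len w)"
  shows "nonneg (act w (simple_root s))"
  using assms
proof (induction "len w" arbitrary: w s rule: less_induct)
  case less
  show ?case
  proof (cases "w = \<one>")
    case True
    then show ?thesis by (simp add: nonneg_simple_root)
  next
    case False
    obtain u where u: "reduced u" "val u = w" using ex_reduced less by blast
    then obtain u' t where ut: "u = u' @ [t]" using False by (cases u rule: rev_cases) auto
    have S: "u' \<in> lists S" "t \<in> S" "s \<in> S" using u ut less.prems by (auto simp: reduced_def)
    have wt: "w = val u' \<otimes> t" using u ut S by (auto simp: val_append S_carrier)
    have lw: "len w = Suc (length u')" using u ut by (simp add: reduced_def)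
    have "t \<noteq> s"
      using less.prems(3) len_le[OF S(1)] wt lw S by auto
    \<comment> \<open>\<open>P\<close> collects the lengths of the left factors of \<open>w\<close> that leave a word in \<open>s\<close> and \<open>t\<close>.\<close>
    define P where "P = (\<lambda>n. \<exists>v p. v \<in> carrier W \<and> set p \<subseteq> {s, t} \<and> w = v \<otimes> val p \<and>
      len v + length p = len w \<and> len v = n)"
    have "len (val u') = length u'"
      using reduced_append(1)[of u' "[t]"] u ut by (simp add: reduced_def)
    then have P0: "P (length u')"
      unfolding P_def using S wt lw by (intro exI[of _ "val u'"] exI[of _ "[t]"]) (auto simp: S_carrier)
    define n where "n = (LEAST n. P n)"
    have "P n" "n \<le> length u'" "\<And>k. P k \<Longrightarrow> n \<le> k"
      unfolding n_def using P0 by (auto intro: LeastI Least_le)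
    then obtain v p where v: "v \<in> carrier W" and p: "set p \<subseteq> {s, t}" and w: "w = v \<otimes> val p"
      and lens: "len v + length p = len w" and vn: "len v = n"
      unfolding P_def by blast
    then have lv: "len v < len w" and min: "\<And>k. P k \<Longrightarrow> len v \<le> k"
      using lw \<open>n \<le> length u'\<close> \<open>\<And>k. P k \<Longrightarrow> n \<le> k\<close> by auto
    have pS: "p \<in> lists S" using p S by auto
    have asc: "len (v \<otimes> r) = Suc (len v)" if r: "r \<in> {s, t}" for r
    proof (rule ccontr)
      assume "\<not> ?thesis"
      then have "len v = Suc (len (v \<otimes> r))" using len_mult_S[of r v] r S v by auto
      moreover have "P (len (v \<otimes> r))"
        unfolding P_def
        using v p r S w lens calculation pS
        by (intro exI[of _ "v \<otimes> r"] exI[of _ "r # p"]) (auto simp: S_carrier m_assoc)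
      ultimately show False using min[of "len (v \<otimes> r)"] by simp
    qed
    have IH: "nonneg (act v (simple_root r))" if r: "r \<in> {s, t}" for r
      using less.hyps[OF lv v] asc[OF r] r S by auto
    have "w \<otimes> s = v \<otimes> val (p @ [s])"
      using w v pS S by (simp add: val_append m_assoc S_carrier)
    then have "len (w \<otimes> s) \<le> len v + len (val (p @ [s]))"
      using len_mult_le[of v "val (p @ [s])"] v pS S by simp
    then have red: "reduced (p @ [s])"
      using less.prems(3) lens len_le[of "p @ [s]"] pS S by (auto simp: reduced_def)
    have pa: "p = alt_word s t (length p)" by (rule reduced_snoc_alternating[OF red p])
    have bound: "enat (Suc (length p)) \<le> m s t"
      using reduced_alternating_length[of s t "length p"] S \<open>t \<noteq> s\<close> red pa by auto
    then have "enat (length p) \<le> m s t" by (rule order_trans[rotated]) simp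
    then obtain a b where ab: "act_word p (simple_root s) = comb a s b t" "0 \<le> a" "0 \<le> b"
      using act_alt_word[of s t "length p"] bound S \<open>t \<noteq> s\<close> pa dihedral_coeff_nonneg[of s t] 
      by (metis (full_types))
    have "act w (simple_root s) = act v (comb a s b t)"
      using w v pS ab by (simp add: act_mult act_val)
    also have "\<dots> = (\<lambda>x. a * act v (simple_root s) x + b * act v (simple_root t) x)"
      using v by (simp add: comb_def act_add act_scale)
    finally show ?thesis using IH ab by simp
  qed
qed

lemma reflect_simple_root: "s \<in> S \<Longrightarrow> reflect s (simple_root s) = (\<lambda>t. - simple_root s t)"
  unfolding reflect_def coroot_simple_root by (auto simp: bform_self simple_root_def)

lemma descent_nonpos:
  assumes "w \<in> carrier W" "s \<in> S" "len w = Suc (len (w \<otimes> s))"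
  shows "nonpos (act w (simple_root s))"
proof -
  have "nonneg (act (w \<otimes> s) (simple_root s))"
    by (rule ascent_nonneg) (use assms S_carrier in auto)
  then show ?thesis
    using assms by (simp add: act_mult S_carrier act_S reflect_simple_root act_uminus)
qed

definition roots :: "('a \<Rightarrow> real) set" where
  "roots = {act w (simple_root s) | w s. w \<in> carrier W \<and> s \<in> S}"

definition pos_roots :: "('a \<Rightarrow> real) set" where
  "pos_roots = {\<beta> \<in> roots. nonneg \<beta>}"

lemma rootsI: "w \<in> carrier W \<Longrightarrow> s \<in> S \<Longrightarrow> act w (simple_root s) \<in> roots"
  unfolding roots_def by blast

lemma simple_root_in_roots: "s \<in> S \<Longrightarrow> simple_root s \<in> roots"
  using rootsI[of "\<one>" s] by simp

lemma simple_root_pos: "s \<in> S \<Longrightarrow> simple_root s \<in> pos_roots"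
  by (simp add: pos_roots_def simple_root_in_roots nonneg_simple_root)

lemma act_root: "w \<in> carrier W \<Longrightarrow> \<beta> \<in> roots \<Longrightarrow> act w \<beta> \<in> roots"
proof -
  assume w: "w \<in> carrier W" and "\<beta> \<in> roots"
  then obtain v s where "v \<in> carrier W" "s \<in> S" "\<beta> = act v (simple_root s)"
    by (auto simp: roots_def)
  then show ?thesis using rootsI[of "w \<otimes> v" s] w by (simp add: act_mult)
qed

lemma reflect_root: "s \<in> S \<Longrightarrow> \<beta> \<in> roots \<Longrightarrow> reflect s \<beta> \<in> roots"
  using act_root[of s \<beta>] by (simp add: act_S S_carrier)

lemma root_sign: "\<beta> \<in> roots \<Longrightarrow> nonneg \<beta> \<or> nonpos \<beta>"
  unfolding roots_def using ascent_nonneg descent_nonpos len_mult_S by blast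

lemma root_nonzero: "\<beta> \<in> roots \<Longrightarrow> \<not> (nonneg \<beta> \<and> nonpos \<beta>)"
proof
  assume "\<beta> \<in> roots" "nonneg \<beta> \<and> nonpos \<beta>"
  then have "\<beta> = (\<lambda>t. 0)" by (intro ext antisym) auto
  then obtain w s where w: "w \<in> carrier W" "s \<in> S" "act w (simple_root s) = (\<lambda>t. 0)"
    using \<open>\<beta> \<in> roots\<close> by (auto simp: roots_def)
  then have "act (inv w) (act w (simple_root s)) = (\<lambda>t. 0)" by (simp add: act_zero)
  then have "simple_root s = (\<lambda>t. 0)" using act_inv(1)[of w "simple_root s"] w(1) by simp
  then show False by (metis simple_root_def zero_neq_one)
qed

lemma root_nonpos_iff: "\<beta> \<in> roots \<Longrightarrow> nonpos \<beta> \<longleftrightarrow> \<not> nonneg \<beta>"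
  using root_sign root_nonzero by blast

lemma act_word_outside: "u \<in> lists S \<Longrightarrow> t \<notin> set u \<Longrightarrow> act_word u x t = x t"
  by (induction u) (auto simp: reflect_def)

lemma root_outside: "\<beta> \<in> roots \<Longrightarrow> t \<notin> S \<Longrightarrow> \<beta> t = 0"
proof -
  assume "\<beta> \<in> roots" and t: "t \<notin> S"
  then obtain w s where w: "w \<in> carrier W" "s \<in> S" "\<beta> = act w (simple_root s)" by (auto simp: roots_def)
  obtain u where u: "u \<in> lists S" "val u = w" using ex_word w by blast
  then have "\<beta> t = simple_root s t"
    using w t act_word_outside[of u t] act_val[of u] by auto
  then show ?thesis using w t by (auto simp: simple_root_def)
qed

definition bil :: "('a \<Rightarrow> real) \<Rightarrow> ('a \<Rightarrow> real) \<Rightarrow> real" where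
  "bil x y = (\<Sum>s\<in>S. x s * coroot s y)"

lemma bil_sym: "bil x y = bil y x"
proof -
  have "bil x y = (\<Sum>s\<in>S. \<Sum>t\<in>S. x s * (bform s t * y t))"
    by (simp add: bil_def coroot_def sum_distrib_left)
  also have "\<dots> = (\<Sum>t\<in>S. \<Sum>s\<in>S. x s * (bform s t * y t))" by (rule sum.swap)
  also have "\<dots> = bil y x"
    unfolding bil_def coroot_def sum_distrib_left
    by (intro sum.cong HOL.refl) (simp add: bform_sym)
  finally show ?thesis .
qed

lemma bil_simple_root: "s \<in> S \<Longrightarrow> bil (simple_root s) x = coroot s x"
  using finite_S by (simp add: bil_def simple_root_def if_distrib[of "\<lambda>a. a * _"] cong: if_cong)

lemma bil_reflect_right: "s \<in> S \<Longrightarrow> bil x (reflect s y) = bil x y - 2 * coroot s x * coroot s y"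
proof -
  assume s: "s \<in> S"
  have "bil x (reflect s y) = (\<Sum>r\<in>S. x r * coroot r y - 2 * coroot s y * (bform s r * x r))"
    unfolding bil_def using s by (intro sum.cong HOL.refl) (simp add: coroot_reflect bform_sym algebra_simps)
  also have "\<dots> = bil x y - 2 * coroot s x * coroot s y"
    by (simp add: sum_subtractf bil_def sum_distrib_left[symmetric] coroot_def[of s x])
  finally show ?thesis .
qed

lemma bil_reflect: "s \<in> S \<Longrightarrow> bil (reflect s x) (reflect s y) = bil x y"
  using bil_reflect_right[of s "reflect s x" y] bil_reflect_right[of s y x]
  by (simp add: bil_sym[of "reflect s x" y] bil_sym[of x y] coroot_reflect bform_self)

lemma bil_act_word: "u \<in> lists S \<Longrightarrow> bil (act_word u x) (act_word u y) = bil x y"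
  by (induction u) (simp_all add: bil_reflect)

lemma bil_act: "w \<in> carrier W \<Longrightarrow> bil (act w x) (act w y) = bil x y"
  using ex_word[of w] bil_act_word by (auto simp: act_val)

lemma bil_root: "\<beta> \<in> roots \<Longrightarrow> bil \<beta> \<beta> = 1"
  by (auto simp: roots_def bil_act bil_simple_root coroot_simple_root bform_self)

text \<open>Having norm one, \<open>\<beta>\<close> cannot be a multiple of the simple root of \<open>s\<close>, so it has a positive
  coordinate that the reflection does not change. As every root has a sign, it stays positive.\<close>

lemma reflect_pos_root:
  assumes "s \<in> S" "\<beta> \<in> pos_roots" "\<beta> \<noteq> simple_root s"
  shows "reflect s \<beta> \<in> pos_roots"
proof -
  have b: "\<beta> \<in> roots" "nonneg \<beta>" using assms by (auto simp: pos_roots_def)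
  have "\<exists>t. t \<noteq> s \<and> \<beta> t \<noteq> 0"
  proof (rule ccontr)
    assume "\<not> ?thesis"
    then have eq: "\<beta> = (\<lambda>t. \<beta> s * simple_root s t)" by (auto simp: simple_root_def fun_eq_iff)
    have "coroot s \<beta> = \<beta> s"
      by (subst eq) (simp add: coroot_scale coroot_simple_root assms bform_self)
    then have "bil \<beta> \<beta> = \<beta> s * \<beta> s"
      unfolding bil_def using \<open>\<not> (\<exists>t. t \<noteq> s \<and> \<beta> t \<noteq> 0)\<close> finite_S assms(1)
      by (subst sum.remove[of _ s]) (auto intro!: sum.neutral)
    then have "\<beta> s * \<beta> s = 1" using bil_root[OF b(1)] by simp
    then have "\<beta> s = 1" using b(2) by (metis abs_mult_self_eq abs_of_nonneg real_sqrt_abs2 real_sqrt_one)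
    then show False using eq assms(3) by simp
  qed
  then obtain t where t: "t \<noteq> s" "\<beta> t > 0" using b(2) by (metis less_eq_real_def)
  then have "reflect s \<beta> t > 0" by (simp add: reflect_def)
  then have "\<not> nonpos (reflect s \<beta>)" by (meson not_less)
  then show ?thesis using reflect_root[OF assms(1) b(1)] root_nonpos_iff by (auto simp: pos_roots_def)
qed


section \<open>Inversions as positive roots\<close>

text \<open>The roots of the inversions of \<open>w\<close>, see \<open>root_reflection\<close>.\<close>

definition inv_roots :: "'a \<Rightarrow> ('a \<Rightarrow> real) set" where
  "inv_roots w = {\<beta> \<in> pos_roots. nonpos (act (inv w) \<beta>)}"

lemma inv_roots_pos: "\<beta> \<in> inv_roots w \<Longrightarrow> \<beta> \<in> pos_roots"
  by (simp add: inv_roots_def)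

lemma inv_roots_one [simp]: "inv_roots \<one> = {}"
  using root_nonzero by (auto simp: inv_roots_def pos_roots_def)

lemma pos_rootD: "\<beta> \<in> pos_roots \<Longrightarrow> \<beta> \<in> roots" "\<beta> \<in> pos_roots \<Longrightarrow> nonneg \<beta>"
  by (auto simp: pos_roots_def)

lemma inv_S_mult: "s \<in> S \<Longrightarrow> w \<in> carrier W \<Longrightarrow> act (inv (s \<otimes> w)) x = act (inv w) (reflect s x)"
  by (simp add: inv_mult_group S_carrier S_inv act_mult act_S)

lemma inv_roots_S_mult:
  assumes "s \<in> S" "w \<in> carrier W" "\<beta> \<in> pos_roots" "\<beta> \<noteq> simple_root s"
  shows "\<beta> \<in> inv_roots (s \<otimes> w) \<longleftrightarrow> reflect s \<beta> \<in> inv_roots w"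
  using assms reflect_pos_root[OF assms(1,3,4)] by (simp add: inv_roots_def inv_S_mult)

lemma simple_root_inv_S_mult:
  assumes "s \<in> S" "w \<in> carrier W"
  shows "simple_root s \<in> inv_roots (s \<otimes> w) \<longleftrightarrow> simple_root s \<notin> inv_roots w"
proof -
  have "act (inv w) (simple_root s) \<in> roots"
    using assms by (intro act_root simple_root_in_roots) auto
  then have "nonneg (act (inv w) (simple_root s)) \<longleftrightarrow> \<not> nonpos (act (inv w) (simple_root s))"
    using root_nonpos_iff by blast
  then show ?thesis
    using assms simple_root_pos[OF assms(1)]
    by (simp add: inv_roots_def inv_S_mult reflect_simple_root act_uminus)
qed

lemma len_S_mult_descent:
  assumes "s \<in> S" "w \<in> carrier W" "simple_root s \<in> inv_roots w"
  shows "len w = Suc (len (s \<otimes> w))"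
proof (rule ccontr)
  assume "\<not> ?thesis"
  then have "len (s \<otimes> w) = Suc (len w)" using len_S_mult assms by blast
  moreover have "len (inv w \<otimes> s) = len (s \<otimes> w)"
    using len_inv[of "s \<otimes> w"] assms by (simp add: inv_mult_group S_carrier S_inv)
  ultimately have "nonneg (act (inv w) (simple_root s))"
    using assms len_inv[of w] by (intro ascent_nonneg) auto
  moreover have "act (inv w) (simple_root s) \<in> roots"
    using assms by (intro act_root simple_root_in_roots) auto
  ultimately show False using assms(3) root_nonzero by (auto simp: inv_roots_def)
qed

lemma len_S_mult_ascent:
  assumes "s \<in> S" "w \<in> carrier W" "simple_root s \<notin> inv_roots w"
  shows "len (s \<otimes> w) = Suc (len w)"
  using len_S_mult_descent[of s "s \<otimes> w"] simple_root_inv_S_mult[of s w] assms S_carrier by simp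

lemma reflect_simple_ne: "s \<in> S \<Longrightarrow> \<beta> \<in> pos_roots \<Longrightarrow> reflect s \<beta> \<noteq> simple_root s"
proof
  assume s: "s \<in> S" and b: "\<beta> \<in> pos_roots" and eq: "reflect s \<beta> = simple_root s"
  have "\<beta> = reflect s (simple_root s)" using reflect_reflect[OF s, of \<beta>] eq by simp
  then have "nonpos \<beta>" using nonneg_simple_root s by (simp add: reflect_simple_root)
  then show False using b root_nonzero by (auto simp: pos_roots_def)
qed

lemma inv_roots_ascent:
  assumes "s \<in> S" "w \<in> carrier W" "simple_root s \<notin> inv_roots w"
  shows "inv_roots (s \<otimes> w) = insert (simple_root s) (reflect s ` inv_roots w)"
proof (intro equalityI subsetI)
  fix \<beta> assume b: "\<beta> \<in> inv_roots (s \<otimes> w)"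
  show "\<beta> \<in> insert (simple_root s) (reflect s ` inv_roots w)"
  proof (cases "\<beta> = simple_root s")
    case False
    then have "reflect s \<beta> \<in> inv_roots w"
      using b inv_roots_S_mult assms inv_roots_pos by blast
    then have "reflect s (reflect s \<beta>) \<in> reflect s ` inv_roots w" by blast
    then show ?thesis using reflect_reflect assms by simp
  qed simp
next
  fix \<beta> assume "\<beta> \<in> insert (simple_root s) (reflect s ` inv_roots w)"
  then consider "\<beta> = simple_root s" | \<gamma> where "\<gamma> \<in> inv_roots w" "\<beta> = reflect s \<gamma>" by blast
  then show "\<beta> \<in> inv_roots (s \<otimes> w)"
  proof cases
    case 1
    then show ?thesis using simple_root_inv_S_mult assms by simp
  next
    case 2
    then have g: "\<gamma> \<noteq> simple_root s" "\<gamma> \<in> pos_roots" using assms inv_roots_pos by auto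
    then show ?thesis
      using 2 inv_roots_S_mult[OF assms(1,2), of \<beta>] reflect_pos_root assms
        reflect_simple_ne[OF assms(1) g(2)] reflect_reflect by simp
  qed
qed

lemma ex_descent:
  assumes "w \<in> carrier W" "w \<noteq> \<one>"
  shows "\<exists>s\<in>S. simple_root s \<in> inv_roots w"
proof -
  obtain u where u: "reduced u" "val u = w" using ex_reduced assms by blast
  then obtain s u' where su: "u = s # u'" using assms by (cases u) auto
  then have s: "s \<in> S" "u' \<in> lists S" "s \<otimes> w = val u'" using u by (auto simp: reduced_def)
  then have "len (s \<otimes> w) < len w" using len_le[of u'] u su by (simp add: reduced_def)
  then show ?thesis using len_S_mult_ascent[of s w] s assms by (intro bexI[of _ s]) (auto intro: ccontr)
qed

text \<open>Together with \<open>inv_roots_ascent\<close> this replaces arguments about reduced words by arguments about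
  sets of roots.\<close>

lemma left_induct [consumes 1, case_names one mult]:
  assumes "w \<in> carrier W" "P \<one>"
    and "\<And>s w. s \<in> S \<Longrightarrow> w \<in> carrier W \<Longrightarrow> simple_root s \<notin> inv_roots w \<Longrightarrow> P w \<Longrightarrow> P (s \<otimes> w)"
  shows "P w"
  using assms(1)
proof (induction "len w" arbitrary: w rule: less_induct)
  case less
  show ?case
  proof (cases "w = \<one>")
    case False
    then obtain s where s: "s \<in> S" "simple_root s \<in> inv_roots w" using ex_descent less by blast
    then have "P (s \<otimes> w)" using less len_S_mult_descent[of s w] S_carrier by auto
    moreover have "simple_root s \<notin> inv_roots (s \<otimes> w)" using simple_root_inv_S_mult s less by blast
    ultimately show ?thesis using assms(3)[of s "s \<otimes> w"] s less S_carrier by simp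
  qed (simp add: assms)
qed

lemma card_inv_roots:
  assumes "w \<in> carrier W"
  shows "finite (inv_roots w)" "card (inv_roots w) = len w"
proof -
  have "finite (inv_roots w) \<and> card (inv_roots w) = len w"
    using assms
  proof (induction rule: left_induct)
    case (mult s w)
    have "simple_root s \<notin> reflect s ` inv_roots w"
      using reflect_simple_ne[OF mult(1)] inv_roots_pos by (metis imageE)
    moreover have "inj_on (reflect s) (inv_roots w)"
      by (rule inj_on_inverseI[of _ "reflect s"]) (simp add: reflect_reflect mult)
    ultimately show ?case
      using mult by (simp add: inv_roots_ascent len_S_mult_ascent card_image)
  qed simp
  then show "finite (inv_roots w)" "card (inv_roots w) = len w" by auto
qed

lemma inv_roots_empty: "w \<in> carrier W \<Longrightarrow> inv_roots w = {} \<Longrightarrow> w = \<one>"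
  using ex_descent by blast

lemma inv_roots_S: "s \<in> S \<Longrightarrow> inv_roots s = {simple_root s}"
  using inv_roots_ascent[of s "\<one>"] by (simp add: S_carrier)

text \<open>Left multiplication by \<open>s\<close> is an isomorphism from the elements not above \<open>s\<close> to the elements
  above \<open>s\<close>, since by \<open>inv_roots_ascent\<close> it reflects the inversions and adds one new root to all
  of them. Inductions on length remove a letter in this way.\<close>

lemma S_mult_subset_iff:
  assumes "s \<in> S" "v \<in> carrier W" "w \<in> carrier W"
    "simple_root s \<notin> inv_roots v" "simple_root s \<notin> inv_roots w"
  shows "inv_roots (s \<otimes> v) \<subseteq> inv_roots (s \<otimes> w) \<longleftrightarrow> inv_roots v \<subseteq> inv_roots w"
proof -
  have inj: "inj (reflect s)" by (rule inj_on_inverseI[of _ "reflect s"]) (simp add: reflect_reflect assms)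
  have "simple_root s \<notin> reflect s ` inv_roots x" for x
    using reflect_simple_ne[OF assms(1)] inv_roots_pos by (metis imageE)
  then have "inv_roots (s \<otimes> v) \<subseteq> inv_roots (s \<otimes> w) \<longleftrightarrow> reflect s ` inv_roots v \<subseteq> reflect s ` inv_roots w"
    using inv_roots_ascent assms by (auto simp: subset_insert)
  then show ?thesis using inj_image_subset_iff[OF inj] by simp
qed

lemma descent_mult:
  assumes "s \<in> S" "w \<in> carrier W" "simple_root s \<in> inv_roots w"
  shows "s \<otimes> w \<in> carrier W" "simple_root s \<notin> inv_roots (s \<otimes> w)" "s \<otimes> (s \<otimes> w) = w"
  using assms simple_root_inv_S_mult S_carrier by auto

lemma S_mult_subset_iff_descent:
  assumes "s \<in> S" "v \<in> carrier W" "w \<in> carrier W"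
    "simple_root s \<in> inv_roots v" "simple_root s \<in> inv_roots w"
  shows "inv_roots (s \<otimes> v) \<subseteq> inv_roots (s \<otimes> w) \<longleftrightarrow> inv_roots v \<subseteq> inv_roots w"
  using S_mult_subset_iff[of s "s \<otimes> v" "s \<otimes> w"] assms descent_mult by simp

text \<open>Inclusion of inversions makes \<open>v\<close> a prefix of \<open>w\<close>: the letters of \<open>v\<close> can be cancelled from
  the left of both, one at a time.\<close>

lemma subset_prefix:
  assumes "v \<in> carrier W" "w \<in> carrier W" "inv_roots v \<subseteq> inv_roots w"
  shows "len v + len (inv v \<otimes> w) = len w"
  using assms
proof (induction arbitrary: w rule: left_induct)
  case (mult s v)
  have s: "simple_root s \<in> inv_roots w" using inv_roots_ascent[OF mult(1-3)] mult.prems by auto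
  note d = descent_mult[OF mult(1) mult.prems(1) s]
  have "inv_roots v \<subseteq> inv_roots (s \<otimes> w)"
    using S_mult_subset_iff[of s v "s \<otimes> w"] mult d by simp
  then have "len v + len (inv v \<otimes> (s \<otimes> w)) = len (s \<otimes> w)" using mult d by blast
  then show ?case
    using len_S_mult_ascent[of s v] len_S_mult_descent[of s w] mult s
    by (simp add: inv_mult_group S_carrier S_inv m_assoc)
qed simp

lemma inv_roots_inj:
  assumes "v \<in> carrier W" "w \<in> carrier W" "inv_roots v = inv_roots w"
  shows "v = w"
proof -
  have "len v = len w" using card_inv_roots(2) assms by metis
  then have "len (inv v \<otimes> w) = 0" using subset_prefix[of v w] assms by simp
  then have "inv v \<otimes> w = \<one>" using len_0_iff assms by simp
  then show ?thesis using assms by (metis inv_equality inv_inv inv_closed)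
qed

text \<open>The action determines the inversions, and these determine the element.\<close>

lemma act_faithful:
  assumes "v \<in> carrier W" "w \<in> carrier W" "\<And>x. act v x = act w x"
  shows "v = w"
proof -
  have "act (inv v) x = act (inv w) x" for x
    using assms(3)[of "act (inv w) x"] act_inv(1)[OF assms(1), of "act (inv w) x"] act_inv assms
    by simp
  then have "inv_roots v = inv_roots w" by (simp add: inv_roots_def)
  then show ?thesis using inv_roots_inj assms by blast
qed

lemma reflection_action:
  assumes "v \<in> carrier W" "s \<in> S"
  shows "act (v \<otimes> s \<otimes> inv v) x
    = (\<lambda>t. x t + (- 2 * bil (act v (simple_root s)) x) * act v (simple_root s) t)"
proof -
  let ?y = "act (inv v) x"
  have "bil (act v (simple_root s)) x = bil (act v (simple_root s)) (act v ?y)" using assms by simp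
  then have b: "bil (act v (simple_root s)) x = coroot s ?y"
    using assms by (simp only: bil_act bil_simple_root)
  have "reflect s ?y = (\<lambda>t. ?y t + (- 2 * coroot s ?y) * simple_root s t)"
    by (auto simp: reflect_def simple_root_def)
  then have "act v (reflect s ?y) = (\<lambda>t. act v ?y t + (- 2 * coroot s ?y) * act v (simple_root s) t)"
    by (simp only: act_add[OF assms(1)] act_scale[OF assms(1)])
  then show ?thesis using assms by (simp add: act_mult S_carrier act_S b)
qed

text \<open>A reflection acts by a formula that only involves its root, and the action is faithful.\<close>

lemma reflection_determined:
  assumes "v \<in> carrier W" "s \<in> S" "w \<in> carrier W" "r \<in> S"
    "act v (simple_root s) = act w (simple_root r)"
  shows "v \<otimes> s \<otimes> inv v = w \<otimes> r \<otimes> inv w"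
  by (rule act_faithful) (use assms S_carrier reflection_action in auto)

text \<open>If \<open>\<beta>\<close> is an inversion, then the root becomes simple after some letters of a reduced word for \<open>w\<close>
  have been removed on the left, and the reflection deletes the next letter. Otherwise
  \<open>\<beta>\<close> is an inversion of \<open>t w\<close>, where \<open>t\<close> is the reflection, so that \<open>t w\<close> is the longer of the two.\<close>

lemma root_reflection:
  assumes "v \<in> carrier W" "s \<in> S" "act v (simple_root s) \<in> pos_roots" "w \<in> carrier W"
  shows "len (v \<otimes> s \<otimes> inv v \<otimes> w) < len w \<longleftrightarrow> act v (simple_root s) \<in> inv_roots w"
proof -
  have dec: "len (v \<otimes> s \<otimes> inv v \<otimes> w) < len w"
    if "v \<in> carrier W" "s \<in> S" "act v (simple_root s) \<in> inv_roots w" "w \<in> carrier W" for v w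
    using that(4,1,2,3)
  proof (induction arbitrary: v rule: left_induct)
    case (mult r w)
    let ?b = "act v (simple_root s)"
    have rc: "r \<in> carrier W" "s \<in> carrier W" using mult S_carrier by auto
    show ?case
    proof (cases "?b = simple_root r")
      case True
      then have "v \<otimes> s \<otimes> inv v = r"
        using reflection_determined[of v s "\<one>" r] mult rc by simp
      then show ?thesis using mult len_S_mult_ascent[of r w] by simp
    next
      case False
      have "reflect r ?b \<in> inv_roots w"
        using inv_roots_S_mult[of r w ?b] False mult inv_roots_pos by blast
      then have "act (r \<otimes> v) (simple_root s) \<in> inv_roots w" using mult rc by (simp add: act_mult act_S)
      then have "len (r \<otimes> v \<otimes> s \<otimes> inv (r \<otimes> v) \<otimes> w) < len w" using mult rc by simp
      moreover have "v \<otimes> s \<otimes> inv v \<otimes> (r \<otimes> w) = r \<otimes> (r \<otimes> v \<otimes> s \<otimes> inv (r \<otimes> v) \<otimes> w)"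
        using mult rc by (simp add: inv_mult_group S_inv m_assoc)
      moreover have "len (r \<otimes> (r \<otimes> v \<otimes> s \<otimes> inv (r \<otimes> v) \<otimes> w))
          \<le> Suc (len (r \<otimes> v \<otimes> s \<otimes> inv (r \<otimes> v) \<otimes> w))"
        using len_S_mult[of r "r \<otimes> v \<otimes> s \<otimes> inv (r \<otimes> v) \<otimes> w"] mult rc by auto
      ultimately show ?thesis using len_S_mult_ascent[of r w] mult by simp
    qed
  qed simp
  let ?t = "v \<otimes> s \<otimes> inv v" and ?b = "act v (simple_root s)"
  have tc: "?t \<in> carrier W" "s \<in> carrier W" using assms S_carrier by auto
  have tt: "?t \<otimes> (?t \<otimes> w) = w" "inv ?t = ?t"
    using assms tc by (simp_all add: m_assoc inv_mult_group S_inv)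
      (simp add: m_assoc[symmetric])
  show ?thesis
  proof
    assume "?b \<in> inv_roots w" then show "len (?t \<otimes> w) < len w" using dec assms by blast
  next
    assume l: "len (?t \<otimes> w) < len w"
    show "?b \<in> inv_roots w"
    proof (rule ccontr)
      assume n: "?b \<notin> inv_roots w"
      have "act (inv w) ?b \<in> roots" using assms act_root rootsI by auto
      then have nn: "nonneg (act (inv w) ?b)"
        using n assms(3) root_nonpos_iff by (auto simp: inv_roots_def)
      have "act ?t ?b = (\<lambda>t. - ?b t)"
        using assms tc by (simp add: act_mult act_S reflect_simple_root act_uminus)
      then have "act (inv (?t \<otimes> w)) ?b = (\<lambda>t. - act (inv w) ?b t)"
        using assms tc tt(2) inv_mult_group[of ?t w] by (simp add: act_mult[of "inv w" ?t] act_uminus)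
      then have "?b \<in> inv_roots (?t \<otimes> w)" using nn assms by (simp add: inv_roots_def)
      then have "len (?t \<otimes> (?t \<otimes> w)) < len (?t \<otimes> w)" using dec assms tc by blast
      then show False using tt l by simp
    qed
  qed
qed

text \<open>A reflection \<open>x s x\<^sup>-\<^sup>1\<close> has the roots \<open>x \<alpha>\<^sub>s\<close> and \<open>x s \<alpha>\<^sub>s = - x \<alpha>\<^sub>s\<close>, one of which is positive.\<close>

lemma inversion_set_subset_iff:
  assumes "v \<in> carrier W" "w \<in> carrier W"
  shows "inversion_set W S v \<subseteq> inversion_set W S w \<longleftrightarrow> inv_roots v \<subseteq> inv_roots w"
proof
  assume sub: "inversion_set W S v \<subseteq> inversion_set W S w"
  show "inv_roots v \<subseteq> inv_roots w"
  proof
    fix \<beta> assume b: "\<beta> \<in> inv_roots v"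
    then have "\<beta> \<in> pos_roots" by (rule inv_roots_pos)
    then obtain x s where x: "x \<in> carrier W" "s \<in> S" "\<beta> = act x (simple_root s)"
      by (auto simp: pos_roots_def roots_def)
    then have "x \<otimes> s \<otimes> inv x \<in> inversion_set W S v"
      using root_reflection[of x s v] \<open>\<beta> \<in> pos_roots\<close> b assms
      unfolding inversion_set_def reflections_def by blast
    then show "\<beta> \<in> inv_roots w"
      using sub root_reflection[of x s w] x \<open>\<beta> \<in> pos_roots\<close> assms unfolding inversion_set_def by blast
  qed
next
  assume sub: "inv_roots v \<subseteq> inv_roots w"
  show "inversion_set W S v \<subseteq> inversion_set W S w"
  proof
    fix t assume t: "t \<in> inversion_set W S v"
    then obtain x s where x: "x \<in> carrier W" "s \<in> S" "t = x \<otimes> s \<otimes> inv x"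
      by (auto simp: inversion_set_def reflections_def)
    obtain x where x: "x \<in> carrier W" "t = x \<otimes> s \<otimes> inv x" "act x (simple_root s) \<in> pos_roots"
    proof (cases "nonneg (act x (simple_root s))")
      case True
      then show ?thesis using that x rootsI by (auto simp: pos_roots_def)
    next
      case False
      have eq: "act (x \<otimes> s) (simple_root s) = (\<lambda>t. - act x (simple_root s) t)"
        using x S_carrier by (simp add: act_mult act_S reflect_simple_root act_uminus)
      moreover have "nonpos (act x (simple_root s))" using False x rootsI root_nonpos_iff by blast
      ultimately have "act (x \<otimes> s) (simple_root s) \<in> pos_roots"
        using rootsI[of "x \<otimes> s" s] x S_carrier by (simp add: pos_roots_def)
      moreover have "t = (x \<otimes> s) \<otimes> s \<otimes> inv (x \<otimes> s)"
        using x S_carrier by (simp add: inv_mult_group S_inv m_assoc)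
      ultimately show ?thesis using that[of "x \<otimes> s"] x S_carrier by simp
    qed
    then show "t \<in> inversion_set W S w"
      using t sub root_reflection[of x s] \<open>s \<in> S\<close> assms unfolding inversion_set_def by blast
  qed
qed


section \<open>Reduced words and parabolic parts\<close>

text \<open>For a reduced word these are the inversions in the order in which the prefixes of the word
  acquire them.\<close>

fun root_seq :: "'a list \<Rightarrow> ('a \<Rightarrow> real) list" where
  "root_seq [] = []"
| "root_seq (s # u) = simple_root s # map (reflect s) (root_seq u)"

lemma root_seq_append: "root_seq (u @ v) = root_seq u @ map (act_word u) (root_seq v)"
  by (induction u) auto

lemma length_root_seq [simp]: "length (root_seq u) = length u"
  by (induction u) auto

lemma reduced_ConsD:
  assumes "reduced (s # u)"
  shows "s \<in> S" "reduced u" "simple_root s \<notin> inv_roots (val u)"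
proof -
  show s: "s \<in> S" using assms by (simp add: reduced_def)
  show u: "reduced u" using reduced_append(2)[of "[s]" u] assms by simp
  show "simple_root s \<notin> inv_roots (val u)"
    using len_S_mult_descent[of s "val u"] s u assms by (auto simp: reduced_def)
qed

lemma set_root_seq: "reduced u \<Longrightarrow> set (root_seq u) = inv_roots (val u)"
proof (induction u)
  case (Cons s u)
  then show ?case
    using reduced_ConsD[OF Cons.prems] inv_roots_ascent[of s "val u"] reducedD(1)[of u]
    by (simp del: in_lists_conv_set)
qed simp

lemma distinct_root_seq: "reduced u \<Longrightarrow> distinct (root_seq u)"
  using card_inv_roots(2)[of "val u"] set_root_seq[of u] reducedD[of u]
  by (intro card_distinct) (metis length_root_seq val_closed)

lemma root_seq_split:
  "\<beta> \<in> set (root_seq u) \<Longrightarrow> \<exists>u1 q u2. u = u1 @ q # u2 \<and> \<beta> = act_word u1 (simple_root q)"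
proof (induction u rule: rev_induct)
  case (snoc q u)
  then consider "\<beta> \<in> set (root_seq u)" | "\<beta> = act_word u (simple_root q)"
    by (auto simp: root_seq_append)
  then show ?case
  proof cases
    case 1
    then obtain u1 p u2 where "u = u1 @ p # u2" "\<beta> = act_word u1 (simple_root p)" using snoc by blast
    then show ?thesis by (intro exI[of _ u1] exI[of _ p] exI[of _ "u2 @ [q]"]) simp
  qed blast
qed simp

definition supported :: "'a set \<Rightarrow> ('a \<Rightarrow> real) \<Rightarrow> bool" where
  "supported J x \<longleftrightarrow> (\<forall>t. t \<notin> J \<longrightarrow> x t = 0)"

lemma supported_reflect: "s \<in> J \<Longrightarrow> supported J (reflect s x) \<longleftrightarrow> supported J x"
  by (auto simp: supported_def reflect_def)

lemma supported_mono: "supported J x \<Longrightarrow> J \<subseteq> K \<Longrightarrow> supported K x"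
  by (auto simp: supported_def)

lemma supported_simple_root: "s \<in> J \<Longrightarrow> supported J (simple_root s)"
  by (auto simp: supported_def simple_root_def)

text \<open>The factor \<open>e\<close> will be \<open>1\<close> or \<open>- 1\<close>, for roots that stay positive and for roots that become
  negative.\<close>

lemma act_supported_sign:
  assumes w: "w \<in> carrier W" and J: "finite J" "supported J x" "nonneg x"
    and "\<And>j. j \<in> J \<Longrightarrow> \<forall>t. 0 \<le> e * act w (simple_root j) t"
  shows "\<forall>t. 0 \<le> e * act w x t"
  using J assms(5)
proof (induction J arbitrary: x rule: finite_induct)
  case empty
  then have "x = (\<lambda>t. 0)" by (auto simp: supported_def)
  then show ?case using act_zero w by simp
next
  case (insert j J)
  have eq: "x = (\<lambda>t. (x(j := 0)) t + x j * simple_root j t)" by (auto simp: simple_root_def)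
  have "\<forall>t. 0 \<le> e * act w (x(j := 0)) t"
  proof (rule insert.IH)
    show "supported J (x(j := 0))" using insert.prems(1) by (auto simp: supported_def)
    show "nonneg (x(j := 0))" using insert.prems(2) by simp
    show "\<forall>t. 0 \<le> e * act w (simple_root i) t" if "i \<in> J" for i
      by (rule insert.prems(3)) (use that in simp)
  qed
  moreover have "\<forall>t. 0 \<le> x j * (e * act w (simple_root j) t)"
    using insert.prems(2) insert.prems(3)[of j] by (simp add: mult_nonneg_nonneg)
  moreover have "act w x = (\<lambda>t. act w (x(j := 0)) t + x j * act w (simple_root j) t)"
    using arg_cong[OF eq, of "act w"] by (simp only: act_add[OF w] act_scale[OF w])
  then have "e * act w x t = e * act w (x(j := 0)) t + x j * (e * act w (simple_root j) t)" for t
    by (simp only: distrib_left mult.left_commute)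
  ultimately show ?case by simp
qed

text \<open>If some \<open>j \<in> J\<close> is below \<open>w\<close>, it can be split off on the left, as its reflection preserves the
  span of \<open>J\<close>. Otherwise \<open>w\<^sup>-\<^sup>1\<close> keeps the simple roots of \<open>J\<close> positive, and therefore all
  positive roots in their span.\<close>

lemma parabolic_part:
  assumes "w \<in> carrier W" "J \<subseteq> S"
  shows "\<exists>v\<in>carrier W. inv_roots v = {\<beta> \<in> inv_roots w. supported J \<beta>}"
  using assms(1)
proof (induction "len w" arbitrary: w rule: less_induct)
  case less
  show ?case
  proof (cases "\<exists>j\<in>J. simple_root j \<in> inv_roots w")
    case True
    then obtain j where j: "j \<in> J" "j \<in> S" "simple_root j \<in> inv_roots w" using assms by blast
    note d = descent_mult[OF j(2) less.prems j(3)]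
    obtain v where v: "v \<in> carrier W" "inv_roots v = {\<beta> \<in> inv_roots (j \<otimes> w). supported J \<beta>}"
      using less.hyps[of "j \<otimes> w"] len_S_mult_descent[OF j(2) less.prems j(3)] d by auto
    have jw: "inv_roots w = insert (simple_root j) (reflect j ` inv_roots (j \<otimes> w))"
      using inv_roots_ascent[of j "j \<otimes> w"] d j by simp
    have "inv_roots (j \<otimes> v) = insert (simple_root j) (reflect j ` inv_roots v)"
      using inv_roots_ascent[of j v] d j v by simp
    also have "\<dots> = {\<beta> \<in> inv_roots w. supported J \<beta>}"
      unfolding jw v(2) using j by (auto simp: supported_reflect supported_simple_root)
    finally show ?thesis using v j S_carrier by (intro bexI[of _ "j \<otimes> v"]) auto
  next
    case False
    have "\<not> supported J \<beta>" if b: "\<beta> \<in> inv_roots w" for \<beta>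
    proof
      assume s: "supported J \<beta>"
      have sj: "nonneg (act (inv w) (simple_root j))" if "j \<in> J" for j
      proof -
        have "j \<in> S" using that assms by blast
        then have "act (inv w) (simple_root j) \<in> roots" using rootsI less by simp
        moreover have "\<not> nonpos (act (inv w) (simple_root j))"
          using False that simple_root_pos[OF \<open>j \<in> S\<close>] by (auto simp: inv_roots_def)
        ultimately show ?thesis using root_nonpos_iff by blast
      qed
      have "nonneg (act (inv w) \<beta>)"
        using act_supported_sign[OF _ finite_subset[OF assms(2) finite_S] s
            pos_rootD(2)[OF inv_roots_pos[OF b]], of "inv w" 1] sj less.prems by simp
      moreover have "nonpos (act (inv w) \<beta>)" using b by (simp add: inv_roots_def)
      moreover have "act (inv w) \<beta> \<in> roots"
        using b less act_root inv_roots_pos pos_rootD(1) by auto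
      ultimately show False using root_nonzero by blast
    qed
    then show ?thesis by (intro bexI[of _ "\<one>"]) auto
  qed
qed

text \<open>Appending a letter to \<open>u\<close> adds at most one inversion to the parabolic part; if it does, then this
  part grows by one letter as well.\<close>

lemma restrict_reduced:
  assumes "reduced u" "J \<subseteq> S"
  shows "\<exists>u'. reduced u' \<and> root_seq u' = filter (supported J) (root_seq u)"
  using assms(1)
proof (induction u rule: rev_induct)
  case Nil
  then show ?case by (intro exI[of _ "[]"]) simp
next
  case (snoc q u)
  have u: "reduced u" "u \<in> lists S" "q \<in> S" using reduced_append(1)[OF snoc.prems] snoc.prems
    by (auto simp: reduced_def)
  obtain u' where u': "reduced u'" "root_seq u' = filter (supported J) (root_seq u)"
    using snoc.IH u by blast
  let ?b = "act_word u (simple_root q)"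
  have rs: "root_seq (u @ [q]) = root_seq u @ [?b]" by (simp add: root_seq_append)
  show ?case
  proof (cases "supported J ?b")
    case False
    then show ?thesis using u' rs by auto
  next
    case True
    obtain x where x: "x \<in> carrier W" "inv_roots x = {\<beta> \<in> inv_roots (val (u @ [q])). supported J \<beta>}"
      using parabolic_part[of "val (u @ [q])" J] assms(2) u by auto
    define v where "v = val u'"
    have v: "v \<in> carrier W" using u' by (auto simp: v_def reduced_def)
    have iv: "inv_roots v = {\<beta> \<in> inv_roots (val u). supported J \<beta>}"
      using set_root_seq[OF u'(1)] set_root_seq[OF u(1)] u'(2) by (simp add: v_def)
    have ix: "inv_roots x = insert ?b (inv_roots v)"
      using x(2) iv set_root_seq[OF snoc.prems] set_root_seq[OF u(1)] rs True by auto
    have nb: "?b \<notin> inv_roots v"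
      using distinct_root_seq[OF snoc.prems] rs iv set_root_seq[OF u(1)] by auto
    have "len x = Suc (len v)"
      using card_inv_roots v x nb ix by (metis card_insert_disjoint)
    then have "len (inv v \<otimes> x) = 1" using subset_prefix[OF v x(1)] ix by auto
    then obtain p where p: "reduced [p]" "val [p] = inv v \<otimes> x"
      using ex_reduced[of "inv v \<otimes> x"] v x
      by (metis One_nat_def length_0_conv length_Suc_conv m_closed inv_closed reducedD(2))
    then have pS: "p \<in> S" by (simp add: reduced_def)
    then have "inv v \<otimes> x = p" using p S_carrier by simp
    then have "v \<otimes> p = x" using v x by (metis inv_closed inv_inv m_closed inv_solve_left)
    then have vp: "val (u' @ [p]) = x" using u' pS v S_carrier by (simp add: val_append reduced_def v_def)
    have red: "reduced (u' @ [p])"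
      using vp \<open>len x = Suc (len v)\<close> u' pS unfolding reduced_def by (auto simp: v_def)
    have "inv_roots x = insert (act_word u' (simple_root p)) (inv_roots v)"
      using set_root_seq[OF red] set_root_seq[OF u'(1)] vp by (simp add: root_seq_append v_def)
    moreover have "act_word u' (simple_root p) \<notin> inv_roots v"
      using distinct_root_seq[OF red] set_root_seq[OF u'(1)] by (simp add: root_seq_append v_def)
    ultimately have "act_word u' (simple_root p) = ?b" using ix nb by blast
    then show ?thesis
      using red u' rs True by (intro exI[of _ "u' @ [p]"]) (simp add: root_seq_append)
  qed
qed

section \<open>The skew form of a Coxeter word\<close>

text \<open>The contribution of the letters of \<open>c\<close> to the inner product with the simple root of \<open>s\<close>.\<close>

definition coroot_on :: "'a list \<Rightarrow> 'a \<Rightarrow> ('a \<Rightarrow> real) \<Rightarrow> real" where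
  "coroot_on c s x = (\<Sum>t\<leftarrow>c. bform s t * x t)"

text \<open>The skew-symmetric form that takes the value \<open>- bform s t\<close> on the simple roots of \<open>s\<close> and \<open>t\<close>
  if \<open>s\<close> comes before \<open>t\<close> in \<open>c\<close>. It depends on \<open>c\<close> only through the order of letters that do not
  commute.\<close>

primrec omega :: "'a list \<Rightarrow> ('a \<Rightarrow> real) \<Rightarrow> ('a \<Rightarrow> real) \<Rightarrow> real" where
  "omega [] x y = 0"
| "omega (s # c) x y = y s * coroot_on c s x - x s * coroot_on c s y + omega c x y"

lemma omega_antisym: "omega c y x = - omega c x y"
  by (induction c) auto

lemma coroot_on_simps [simp]: "coroot_on [] s x = 0" "coroot_on (t # c) s x = bform s t * x t + coroot_on c s x"
  "coroot_on (c @ d) s x = coroot_on c s x + coroot_on d s x"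
  by (simp_all add: coroot_on_def)

lemma coroot_on_cong: "(\<And>t. t \<in> set c \<Longrightarrow> x t = y t) \<Longrightarrow> coroot_on c s x = coroot_on c s y"
  by (induction c) auto

lemma omega_cong:
  "(\<And>t. t \<in> set c \<Longrightarrow> x t = x' t) \<Longrightarrow> (\<And>t. t \<in> set c \<Longrightarrow> y t = y' t) \<Longrightarrow> omega c x y = omega c x' y'"
  by (induction c) (auto cong: coroot_on_cong)

lemma omega_drop: "x s = 0 \<Longrightarrow> y s = 0 \<Longrightarrow> omega (c @ s # d) x y = omega (c @ d) x y"
  by (induction c) auto

lemma coroot_on_linear: "coroot_on c s (\<lambda>t. x t + k * y t) = coroot_on c s x + k * coroot_on c s y"
  by (induction c) (auto simp: algebra_simps)

lemma omega_linear: "omega c (\<lambda>t. x t + k * y t) z = omega c x z + k * omega c y z"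
  by (induction c) (auto simp: algebra_simps coroot_on_linear)

lemma omega_snoc:
  assumes "set c \<subseteq> S" "s \<in> S"
  shows "omega (c @ [s]) x y = omega c x y + x s * coroot_on c s y - y s * coroot_on c s x"
  using assms by (induction c) (auto simp: algebra_simps bform_sym)

lemma coroot_on_zero: "(\<And>t. t \<in> set c \<Longrightarrow> x t = 0) \<Longrightarrow> coroot_on c s x = 0"
  by (induction c) auto

lemma omega_zero: "(\<And>t. t \<in> set c \<Longrightarrow> x t = 0) \<Longrightarrow> omega c x y = 0"
  by (induction c) (auto simp: coroot_on_zero)

lemma coroot_eq_coroot_on:
  assumes "distinct (s # c)" "set (s # c) \<subseteq> S" "supported (set (s # c)) x"
  shows "coroot s x = x s + coroot_on c s x"
proof -
  have "coroot s x = (\<Sum>t\<in>set (s # c). bform s t * x t)"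
    unfolding coroot_def using assms finite_S by (intro sum.mono_neutral_right) (auto simp: supported_def)
  also have "\<dots> = coroot_on (s # c) s x" unfolding coroot_on_def using assms by (subst sum_list_distinct_conv_sum_set) auto
  finally show ?thesis using assms by (simp add: bform_self)
qed

text \<open>Moving \<open>s\<close> from the front to the end of the word changes the sign of the terms that involve \<open>s\<close>.
  The reflection makes up for this: it replaces \<open>x s\<close> by \<open>- x s\<close> minus twice a functional of the
  other coordinates, and the contributions of these functionals cancel by skew symmetry.\<close>

lemma omega_rotate:
  assumes "distinct (s # c)" "set (s # c) \<subseteq> S" "supported (set (s # c)) x" "supported (set (s # c)) y"
  shows "omega (c @ [s]) (reflect s x) (reflect s y) = omega (s # c) x y"
proof -
  have off: "reflect s z t = z t" if "t \<in> set c" for z t using that assms by (auto simp: reflect_def)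
  have "coroot_on c s (reflect s z) = coroot_on c s z" for z by (rule coroot_on_cong) (rule off)
  moreover have "omega c (reflect s x) (reflect s y) = omega c x y" by (rule omega_cong) (rule off, assumption)+
  moreover have "reflect s x s = - x s - 2 * coroot_on c s x" "reflect s y s = - y s - 2 * coroot_on c s y"
    using coroot_eq_coroot_on assms by (simp_all add: reflect_def)
  ultimately show ?thesis using assms by (simp add: omega_snoc) (simp add: algebra_simps)
qed

lemma omega_initial:
  assumes "distinct (s # c)" "set (s # c) \<subseteq> S"
  shows "omega (s # c) (simple_root s) x = - coroot_on c s x"
    "omega (c @ [s]) (simple_root s) x = coroot_on c s x"
proof -
  have "coroot_on c s (simple_root s) = 0" using assms by (intro coroot_on_zero) (auto simp: simple_root_def)
  moreover have "omega c (simple_root s) x = 0" using assms by (intro omega_zero) (auto simp: simple_root_def)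
  ultimately show "omega (s # c) (simple_root s) x = - coroot_on c s x"
    "omega (c @ [s]) (simple_root s) x = coroot_on c s x"
    using assms by (simp_all add: omega_snoc) (simp_all add: simple_root_def)
qed

text \<open>By \<open>omega_initial\<close> this is the sign of \<open>omega\<close> between the first or last letter and a positive
  root. The products of distinct simple roots are nonpositive, which gives the inequality. In the
  case of equality the inner product of \<open>x\<close> with the simple root of \<open>s\<close> is \<open>x s\<close>, so the
  reflection replaces the coordinate \<open>x s\<close> by \<open>- x s\<close>, and both are nonnegative.\<close>

lemma initial_sign:
  assumes "distinct (s # c)" "set (s # c) \<subseteq> S" "x \<in> pos_roots" "supported (set (s # c)) x"
  shows "coroot_on c s x \<le> 0" "coroot_on c s x = 0 \<Longrightarrow> x \<noteq> simple_root s \<Longrightarrow> x s = 0 \<and> coroot s x = 0"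
proof -
  have x: "nonneg x" using assms pos_rootD by blast
  show "coroot_on c s x \<le> 0"
    unfolding coroot_on_def using assms x
    by (intro sum_list_nonpos) (auto intro!: mult_nonpos_nonneg bform_nonpos)
  assume "coroot_on c s x = 0" "x \<noteq> simple_root s"
  then have "coroot s x = x s" using coroot_eq_coroot_on assms by simp
  moreover have "nonneg (reflect s x)"
    using reflect_pos_root[of s x] assms \<open>x \<noteq> simple_root s\<close> pos_rootD by auto
  then have "0 \<le> reflect s x s" by blast
  ultimately have "x s \<le> 0" by (simp add: reflect_def)
  then show "x s = 0 \<and> coroot s x = 0" using x \<open>coroot s x = x s\<close> by (simp add: antisym)
qed

section \<open>Sortability by the skew form\<close>

definition omega_compat :: "'a list \<Rightarrow> ('a \<Rightarrow> real) \<Rightarrow> ('a \<Rightarrow> real) \<Rightarrow> bool" where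
  "omega_compat c \<beta> \<gamma> \<longleftrightarrow> 0 \<le> omega c \<beta> \<gamma> \<and> (omega c \<beta> \<gamma> = 0 \<longrightarrow> bil \<beta> \<gamma> = 0)"

text \<open>Sortability in terms of roots. The condition on supports places \<open>w\<close> in the parabolic subgroup
  generated by the letters of \<open>c\<close>, which need not be all of \<open>S\<close>: inductions remove letters
  from \<open>c\<close>.\<close>

definition omega_sortable :: "'a list \<Rightarrow> 'a \<Rightarrow> bool" where
  "omega_sortable c w \<longleftrightarrow> (\<exists>u. reduced u \<and> val u = w \<and> (\<forall>\<beta>\<in>inv_roots w. supported (set c) \<beta>) \<and>
     sorted_wrt (omega_compat c) (root_seq u))"

lemma omega_sortable_closed: "omega_sortable c w \<Longrightarrow> w \<in> carrier W"
  by (auto simp: omega_sortable_def reduced_def)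

lemma omega_sortable_supported: "omega_sortable c w \<Longrightarrow> \<beta> \<in> inv_roots w \<Longrightarrow> supported (set c) \<beta>"
  by (auto simp: omega_sortable_def)

lemma omega_sortable_one: "omega_sortable c \<one>"
  unfolding omega_sortable_def by (intro exI[of _ "[]"]) (auto simp: reduced_def)

lemma omega_sortable_Nil: "omega_sortable [] w \<Longrightarrow> w = \<one>"
proof -
  assume w: "omega_sortable [] w"
  have False if b: "\<beta> \<in> inv_roots w" for \<beta>
  proof -
    have "\<beta> = (\<lambda>t. 0)" using omega_sortable_supported[OF w b] by (auto simp: supported_def)
    then show False using root_nonzero[of \<beta>] pos_rootD(1)[OF inv_roots_pos[OF b]] by simp
  qed
  then show ?thesis using inv_roots_empty omega_sortable_closed[OF w] by blast
qed

lemma sorted_wrt_compat_drop: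
  assumes "\<And>\<beta>. \<beta> \<in> set bs \<Longrightarrow> \<beta> s = 0"
  shows "sorted_wrt (omega_compat (c @ s # d)) bs \<longleftrightarrow> sorted_wrt (omega_compat (c @ d)) bs"
  using assms by (induction bs) (auto simp: omega_compat_def omega_drop)

lemma omega_sortable_insert:
  assumes "omega_sortable (c @ d) w" "s \<notin> set (c @ d)"
  shows "omega_sortable (c @ s # d) w"
proof -
  obtain u where u: "reduced u" "val u = w" "\<forall>\<beta>\<in>inv_roots w. supported (set (c @ d)) \<beta>"
    "sorted_wrt (omega_compat (c @ d)) (root_seq u)" using assms by (auto simp: omega_sortable_def)
  have "\<beta> s = 0" if "\<beta> \<in> set (root_seq u)" for \<beta>
    using that u(3) assms(2) set_root_seq[OF u(1)] u(2) by (auto simp: supported_def)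
  then have "sorted_wrt (omega_compat (c @ s # d)) (root_seq u)" using u(4) sorted_wrt_compat_drop by blast
  moreover have "\<forall>\<beta>\<in>inv_roots w. supported (set (c @ s # d)) \<beta>"
    using u(3) by (auto intro: supported_mono)
  ultimately show ?thesis using u unfolding omega_sortable_def by blast
qed

lemma omega_sortable_drop_unused:
  assumes "omega_sortable (c @ s # d) w" "\<And>\<beta>. \<beta> \<in> inv_roots w \<Longrightarrow> \<beta> s = 0"
  shows "omega_sortable (c @ d) w"
proof -
  obtain u where u: "reduced u" "val u = w" "\<forall>\<beta>\<in>inv_roots w. supported (set (c @ s # d)) \<beta>"
    "sorted_wrt (omega_compat (c @ s # d)) (root_seq u)" using assms by (auto simp: omega_sortable_def)
  have "sorted_wrt (omega_compat (c @ d)) (root_seq u)"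
    using u(4) sorted_wrt_compat_drop[of "root_seq u" s c d] assms(2) set_root_seq[OF u(1)] u(2) by simp
  moreover have "supported (set (c @ d)) \<beta>" if "\<beta> \<in> inv_roots w" for \<beta>
    using u(3) assms(2) that unfolding supported_def by (metis Un_iff set_ConsD set_append)
  ultimately show ?thesis using u unfolding omega_sortable_def by blast
qed

lemma omega_sortable_simple: "s \<in> S \<Longrightarrow> s \<in> set c \<Longrightarrow> omega_sortable c s"
  unfolding omega_sortable_def
  using len_S_mult[of s "\<one>"] inv_roots_S[of s] S_carrier[of s]
  by (intro exI[of _ "[s]"]) (auto simp: reduced_def supported_simple_root)

text \<open>The list of roots for \<open>s w\<close> is the reflected list for \<open>w\<close> preceded by the simple root of \<open>s\<close>. The
  form on the reflected part is the rotated one, and the first root is compatible with all others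
  because \<open>s\<close> is initial.\<close>

lemma omega_sortable_prepend:
  assumes c: "distinct (s # c)" "set (s # c) \<subseteq> S" and w: "omega_sortable (c @ [s]) w" "simple_root s \<notin> inv_roots w"
  shows "omega_sortable (s # c) (s \<otimes> w)"
proof -
  obtain u where u: "reduced u" "val u = w" "\<forall>\<beta>\<in>inv_roots w. supported (set (c @ [s])) \<beta>"
    "sorted_wrt (omega_compat (c @ [s])) (root_seq u)" using w by (auto simp: omega_sortable_def)
  have sS: "s \<in> S" and wc: "w \<in> carrier W" using c w omega_sortable_closed by auto
  have red: "reduced (s # u)"
    using u sS len_S_mult_ascent[OF sS wc w(2)] by (auto simp: reduced_def)
  have iv: "inv_roots (s \<otimes> w) = insert (simple_root s) (reflect s ` inv_roots w)"
    by (rule inv_roots_ascent[OF sS wc w(2)])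
  have ru: "set (root_seq u) = inv_roots w" using set_root_seq u by blast
  have supp: "supported (set (s # c)) \<beta>" if "\<beta> \<in> inv_roots w" for \<beta> using u(3) that by auto
  have first: "omega_compat (s # c) (simple_root s) (reflect s \<beta>)" if b: "\<beta> \<in> inv_roots w" for \<beta>
  proof -
    have p: "reflect s \<beta> \<in> pos_roots" "reflect s \<beta> \<noteq> simple_root s" "supported (set (s # c)) (reflect s \<beta>)"
      using b inv_roots_pos reflect_pos_root sS w reflect_simple_ne supp by (auto simp: supported_reflect)
    show ?thesis
      using initial_sign[OF c p(1,3)] p(2) omega_initial(1)[OF c] bil_simple_root[OF sS]
      by (auto simp: omega_compat_def)
  qed
  have rest: "omega_compat (s # c) (reflect s \<beta>) (reflect s \<gamma>)"
    if "\<beta> \<in> inv_roots w" "\<gamma> \<in> inv_roots w" "omega_compat (c @ [s]) \<beta> \<gamma>" for \<beta> \<gamma>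
    using that(3) omega_rotate[OF c, of "reflect s \<beta>" "reflect s \<gamma>"] supp that sS
    by (simp add: omega_compat_def supported_reflect reflect_reflect bil_reflect)
  have "sorted_wrt (\<lambda>\<beta> \<gamma>. omega_compat (s # c) (reflect s \<beta>) (reflect s \<gamma>)) (root_seq u)"
    by (rule sorted_wrt_mono_rel[OF _ u(4)], rule rest) (simp_all add: ru)
  then have "sorted_wrt (omega_compat (s # c)) (root_seq (s # u))"
    using first ru by (simp add: sorted_wrt_map)
  moreover have "\<forall>\<beta>\<in>inv_roots (s \<otimes> w). supported (set (s # c)) \<beta>"
    unfolding iv using supp by (auto simp: supported_simple_root supported_reflect)
  ultimately show ?thesis using red u(2) unfolding omega_sortable_def by (intro exI[of _ "s # u"]) auto
qed

text \<open>The simple root of \<open>s\<close> is \<open>u1 \<alpha>\<^sub>q\<close> for some letter \<open>q\<close> after a prefix \<open>u1\<close>, which means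
  \<open>s u1 = u1 q\<close>: left multiplication by \<open>s\<close> deletes \<open>q\<close>. The roots of the prefix are not affected.\<close>

lemma delete_letter:
  assumes u: "reduced u" "val u = w" and s: "s \<in> S" "simple_root s \<in> inv_roots w"
  obtains u' xs ys where "reduced u'" "val u' = s \<otimes> w"
    "root_seq u = xs @ simple_root s # map (reflect s) ys" "root_seq u' = xs @ ys"
proof -
  obtain u1 q u2 where q: "u = u1 @ q # u2" "simple_root s = act_word u1 (simple_root q)"
    using root_seq_split[of "simple_root s" u] set_root_seq[OF u(1)] u s by blast
  have S: "u1 \<in> lists S" "q \<in> S" "u2 \<in> lists S" using u q by (auto simp: reduced_def)
  have c: "val u1 \<in> carrier W" "val u2 \<in> carrier W" "q \<in> carrier W" "s \<in> carrier W"
    using S s S_carrier by auto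
  have wc: "w \<in> carrier W" using u by (auto simp: reduced_def)
  have "act (val u1) (simple_root q) = act \<one> (simple_root s)" using q S by (simp add: act_val)
  then have "val u1 \<otimes> q \<otimes> inv (val u1) = s"
    using reflection_determined[of "val u1" q "\<one>" s] S s c by simp
  then have conj: "val u1 \<otimes> q = s \<otimes> val u1"
    using c by (metis inv_closed inv_solve_right m_closed)
  have "w = val u1 \<otimes> q \<otimes> val u2" using u q S c by (auto simp: val_append m_assoc)
  then have "s \<otimes> w = val (u1 @ u2)"
    using conj S s c by (simp add: val_append m_assoc)
  moreover have "reduced (u1 @ u2)"
    using calculation len_S_mult_descent[OF s(1) wc s(2)] u q S by (simp add: reduced_def)
  moreover have "act_word u1 (reflect q x) = reflect s (act_word u1 x)" for x
  proof -
    have "act_word u1 (reflect q x) = act (val u1 \<otimes> q) x" using S c by (simp add: act_mult act_val act_S)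
    also have "\<dots> = reflect s (act_word u1 x)" unfolding conj using S c s by (simp add: act_mult act_val act_S)
    finally show ?thesis .
  qed
  then have "root_seq u = root_seq u1 @ simple_root s # map (reflect s) (map (act_word u1) (root_seq u2))"
    using q by (simp add: root_seq_append)
  ultimately show ?thesis
    by (intro that[of "u1 @ u2" "root_seq u1" "map (act_word u1) (root_seq u2)"])
      (simp_all add: root_seq_append)
qed

text \<open>A root listed before the simple root of \<open>s\<close> has \<open>omega\<close> of one sign with it because the list is
  sorted, and of the other sign because \<open>s\<close> is initial. Hence it is orthogonal to the simple root
  of \<open>s\<close> and fixed by the reflection, and the list for \<open>s w\<close> is the reflection of the rest of the
  list for \<open>w\<close>.\<close>

lemma omega_sortable_left_mult:
  assumes c: "distinct (s # c)" "set (s # c) \<subseteq> S" and w: "omega_sortable (s # c) w" "simple_root s \<in> inv_roots w"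
  shows "omega_sortable (c @ [s]) (s \<otimes> w)"
proof -
  obtain u where u: "reduced u" "val u = w" "\<forall>\<beta>\<in>inv_roots w. supported (set (s # c)) \<beta>"
    "sorted_wrt (omega_compat (s # c)) (root_seq u)" using w by (auto simp: omega_sortable_def)
  have sS: "s \<in> S" and wc: "w \<in> carrier W" using c w omega_sortable_closed by auto
  obtain u' xs ys where u': "reduced u'" "val u' = s \<otimes> w"
    "root_seq u = xs @ simple_root s # map (reflect s) ys" "root_seq u' = xs @ ys"
    by (rule delete_letter[OF u(1,2) sS w(2)])
  have ru: "set (root_seq u) = inv_roots w" using set_root_seq u by blast
  have fix_s: "reflect s \<beta> = \<beta>" if b: "\<beta> \<in> set xs" for \<beta>
  proof -
    have bw: "\<beta> \<in> inv_roots w" using b u'(3) ru by auto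
    have "omega_compat (s # c) \<beta> (simple_root s)" using u(4) b u'(3) by (auto simp: sorted_wrt_append)
    moreover have "omega (s # c) (simple_root s) \<beta> \<ge> 0"
      using initial_sign(1)[OF c] omega_initial(1)[OF c] bw inv_roots_pos u(3) by auto
    ultimately have "bil \<beta> (simple_root s) = 0"
      using omega_antisym[of "s # c" \<beta> "simple_root s"] by (simp add: omega_compat_def del: omega.simps)
    then show ?thesis using bil_simple_root[OF sS] bil_sym reflect_fix by metis
  qed
  let ?zs = "xs @ map (reflect s) ys"
  have "map (reflect s) xs = xs" using fix_s by (simp add: map_idI)
  then have eq: "root_seq u' = map (reflect s) ?zs"
    using u'(4) sS by (simp add: comp_def reflect_reflect)
  have zs: "sorted_wrt (omega_compat (s # c)) ?zs" using u(4) u'(3) by (auto simp: sorted_wrt_append)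
  have zs_w: "\<beta> \<in> inv_roots w" if "\<beta> \<in> set ?zs" for \<beta> using that u'(3) ru by auto
  have rotated: "omega_compat (c @ [s]) (reflect s \<beta>) (reflect s \<gamma>)"
    if "\<beta> \<in> set ?zs" "\<gamma> \<in> set ?zs" "omega_compat (s # c) \<beta> \<gamma>" for \<beta> \<gamma>
  proof -
    have "supported (set (s # c)) \<beta>" "supported (set (s # c)) \<gamma>" using zs_w that u(3) by blast+
    then show ?thesis using that(3) omega_rotate[OF c] sS by (simp add: omega_compat_def bil_reflect)
  qed
  have "sorted_wrt (\<lambda>\<beta> \<gamma>. omega_compat (c @ [s]) (reflect s \<beta>) (reflect s \<gamma>)) ?zs"
    by (rule sorted_wrt_mono_rel[OF _ zs], rule rotated)
  then have "sorted_wrt (omega_compat (c @ [s])) (root_seq u')"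
    unfolding eq sorted_wrt_map .
  moreover have "supported (set (c @ [s])) \<beta>" if "\<beta> \<in> inv_roots (s \<otimes> w)" for \<beta>
  proof -
    have "\<beta> \<in> set (root_seq u')" using that set_root_seq[OF u'(1)] u'(2) by simp
    then obtain \<gamma> where "\<gamma> \<in> inv_roots w" "\<beta> = reflect s \<gamma>" unfolding eq using zs_w by auto
    then show ?thesis using u(3) by (simp add: supported_reflect)
  qed
  ultimately show ?thesis using u' unfolding omega_sortable_def by blast
qed

text \<open>The same argument for a final letter applies to the roots listed after the simple root of \<open>s\<close>.
  Since the reflection fixes these, the list for \<open>s w\<close> is the list for \<open>w\<close> with one root
  removed, and it is sorted for the same word instead of a rotated one.\<close>

lemma omega_sortable_final_left_mult:
  assumes c: "distinct (s # c)" "set (s # c) \<subseteq> S" and w: "omega_sortable (c @ [s]) w" "simple_root s \<in> inv_roots w"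
  shows "omega_sortable (c @ [s]) (s \<otimes> w)"
proof -
  obtain u where u: "reduced u" "val u = w" "\<forall>\<beta>\<in>inv_roots w. supported (set (c @ [s])) \<beta>"
    "sorted_wrt (omega_compat (c @ [s])) (root_seq u)" using w by (auto simp: omega_sortable_def)
  have sS: "s \<in> S" and wc: "w \<in> carrier W" using c w omega_sortable_closed by auto
  obtain u' xs ys where u': "reduced u'" "val u' = s \<otimes> w"
    "root_seq u = xs @ simple_root s # map (reflect s) ys" "root_seq u' = xs @ ys"
    by (rule delete_letter[OF u(1,2) sS w(2)])
  have ru: "set (root_seq u) = inv_roots w" using set_root_seq u by blast
  have fix_s: "reflect s \<beta> = \<beta>" if b: "\<beta> \<in> set (map (reflect s) ys)" for \<beta>
  proof -
    have bw: "\<beta> \<in> inv_roots w" using b u'(3) ru by auto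
    have "simple_root s \<notin> set (map (reflect s) ys)"
      using distinct_root_seq[OF u(1)] u'(3) by simp
    then have ne: "\<beta> \<noteq> simple_root s" using b by metis
    have "omega_compat (c @ [s]) (simple_root s) \<beta>" using u(4) b u'(3) by (auto simp: sorted_wrt_append)
    then have "coroot_on c s \<beta> \<ge> 0" unfolding omega_compat_def omega_initial(2)[OF c] by blast
    moreover have "\<beta> \<in> pos_roots" "supported (set (s # c)) \<beta>" using bw inv_roots_pos u(3) by auto
    ultimately have "coroot s \<beta> = 0" using initial_sign[OF c] ne by force
    then show ?thesis by (rule reflect_fix)
  qed
  have "reflect s \<beta> = \<beta>" if "\<beta> \<in> set ys" for \<beta>
  proof -
    have "reflect s (reflect s \<beta>) = reflect s \<beta>" by (rule fix_s) (use that in simp)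
    then show ?thesis unfolding reflect_reflect[OF sS] by simp
  qed
  then have "map (reflect s) ys = ys" by (simp add: map_idI)
  then have rs: "root_seq u = xs @ simple_root s # ys" using u'(3) by simp
  then have "sorted_wrt (omega_compat (c @ [s])) (root_seq u')"
    using u(4) u'(4) by (simp add: sorted_wrt_append)
  moreover have "inv_roots (s \<otimes> w) \<subseteq> inv_roots w"
    using set_root_seq[OF u'(1)] u'(2,4) rs ru by auto
  ultimately show ?thesis using u' u(3) unfolding omega_sortable_def by blast
qed

text \<open>The root \<open>u \<alpha>\<^sub>s\<close> is \<open>\<alpha>\<^sub>s\<close> plus a nonnegative combination of the roots of \<open>u\<close>: each further letter
  \<open>r\<close> adds the multiple \<open>- 2 * bform r s\<close> of the root at this letter.\<close>

lemma act_simple_root_increasing: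
  assumes "set u \<subseteq> S" "s \<in> S" "s \<notin> set u"
    and linear: "\<And>x k y. f (\<lambda>t. x t + k * y t) = f x + k * (f y :: real)"
    and "\<And>\<beta>. \<beta> \<in> set (root_seq u) \<Longrightarrow> 0 \<le> f \<beta>"
  shows "f (simple_root s) \<le> f (act_word u (simple_root s))"
  using assms(1,3,5)
proof (induction u rule: rev_induct)
  case (snoc r u)
  have r: "r \<in> S" "r \<noteq> s" using snoc by auto
  have "reflect r (simple_root s) = (\<lambda>t. simple_root s t + (- 2 * bform r s) * simple_root r t)"
    using coroot_simple_root[OF assms(2)] by (auto simp: reflect_def simple_root_def)
  then have "act_word (u @ [r]) (simple_root s)
      = (\<lambda>t. act_word u (simple_root s) t + (- 2 * bform r s) * act_word u (simple_root r) t)"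
    by (simp add: act_word_add act_word_scale del: mult_minus_left)
  then have "f (act_word (u @ [r]) (simple_root s))
      = f (act_word u (simple_root s)) + (- 2 * bform r s) * f (act_word u (simple_root r))"
    by (simp only: linear)
  moreover have "0 \<le> - 2 * bform r s" "0 \<le> f (act_word u (simple_root r))"
    using bform_nonpos[OF r(1) assms(2) r(2)] snoc.prems(3)[of "act_word u (simple_root r)"]
    by (simp_all add: root_seq_append)
  then have "0 \<le> (- 2 * bform r s) * f (act_word u (simple_root r))"
    by (rule mult_nonneg_nonneg)
  moreover have "f (simple_root s) \<le> f (act_word u (simple_root s))"
    using snoc by (auto simp: root_seq_append)
  ultimately show ?case by linarith
qed simp

lemma root_seq_coordinate:
  assumes "set u \<subseteq> S" "s \<notin> set u" "\<beta> \<in> set (root_seq u)"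
  shows "\<beta> s = 0"
proof -
  obtain u1 q u2 where u: "u = u1 @ q # u2" "\<beta> = act_word u1 (simple_root q)"
    using root_seq_split assms by blast
  then have "\<beta> s = simple_root q s" using assms act_word_outside[of u1 s] by auto
  then show ?thesis using assms u by (simp add: simple_root_def)
qed

text \<open>Suppose that \<open>s\<close> occurs in the word, and let \<open>x\<close> be the root of its first occurrence. By
  \<open>act_simple_root_increasing\<close>, applied to \<open>omega\<close> with second argument \<open>x\<close>, the value of \<open>omega\<close>
  at \<open>\<alpha>\<^sub>s\<close> and \<open>x\<close> is at most \<open>omega x x = 0\<close>. Since \<open>s\<close> is initial and \<open>x \<noteq> \<alpha>\<^sub>s\<close>, this forces
  \<open>x s = 0\<close>. But \<open>x s = 1\<close>, as no earlier letter changes this coordinate.\<close>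

lemma omega_sortable_no_descent:
  assumes c: "distinct (s # c)" "set (s # c) \<subseteq> S" and w: "omega_sortable (s # c) w" "simple_root s \<notin> inv_roots w"
  shows "omega_sortable c w"
proof -
  obtain u where u: "reduced u" "val u = w" "\<forall>\<beta>\<in>inv_roots w. supported (set (s # c)) \<beta>"
    "sorted_wrt (omega_compat (s # c)) (root_seq u)" using w by (auto simp: omega_sortable_def)
  have sS: "s \<in> S" and wc: "w \<in> carrier W" using c w omega_sortable_closed by auto
  have uS: "set u \<subseteq> S" using u by (auto simp: reduced_def)
  have ru: "set (root_seq u) = inv_roots w" using set_root_seq u by blast
  have "s \<notin> set u"
  proof
    assume "s \<in> set u"
    then obtain u1 u2 where u12: "u = u1 @ s # u2" "s \<notin> set u1" by (metis split_list_first)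
    let ?x = "act_word u1 (simple_root s)"
    have rs: "root_seq u = root_seq u1 @ ?x # map (act_word u1) (map (reflect s) (root_seq u2))"
      using u12 by (simp add: root_seq_append)
    then have x: "?x \<in> inv_roots w" using ru by auto
    have "\<And>\<beta>. \<beta> \<in> set (root_seq u1) \<Longrightarrow> 0 \<le> omega (s # c) \<beta> ?x"
      using u(4) rs by (auto simp: sorted_wrt_append omega_compat_def)
    then have "omega (s # c) (simple_root s) ?x \<le> omega (s # c) ?x ?x"
      using uS u12 sS by (intro act_simple_root_increasing[where f = "\<lambda>y. omega (s # c) y ?x"] omega_linear) auto
    also have "\<dots> = 0" using omega_antisym[of "s # c" ?x ?x] by simp
    finally have "0 \<le> coroot_on c s ?x" unfolding omega_initial(1)[OF c] by simp
    moreover have "?x \<noteq> simple_root s" using x w by metis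
    ultimately have "?x s = 0"
      using initial_sign[OF c, of ?x] x inv_roots_pos u(3) by force
    moreover have "?x s = 1" using u12 uS act_word_outside[of u1 s] by (simp add: simple_root_def subset_iff)
    ultimately show False by simp
  qed
  then have "\<beta> s = 0" if "\<beta> \<in> inv_roots w" for \<beta> using root_seq_coordinate uS that ru by blast
  then show ?thesis using omega_sortable_drop_unused[of "[]" s c] w(1) by simp
qed

text \<open>A sublist of a sorted list is sorted, and by \<open>restrict_reduced\<close> the roots in the span of \<open>J\<close> are
  the list of a reduced word.\<close>

lemma omega_sortable_restrict:
  assumes "omega_sortable c w" "J \<subseteq> S"
  obtains v where "omega_sortable c v" "inv_roots v = {\<beta> \<in> inv_roots w. supported J \<beta>}"
proof -
  obtain u where u: "reduced u" "val u = w" "\<forall>\<beta>\<in>inv_roots w. supported (set c) \<beta>"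
    "sorted_wrt (omega_compat c) (root_seq u)" using assms by (auto simp: omega_sortable_def)
  obtain u' where u': "reduced u'" "root_seq u' = filter (supported J) (root_seq u)"
    using restrict_reduced u assms by blast
  have iv: "inv_roots (val u') = {\<beta> \<in> inv_roots w. supported J \<beta>}"
    using set_root_seq[OF u'(1)] set_root_seq[OF u(1)] u(2) u'(2) by simp
  have "omega_sortable c (val u')"
    unfolding omega_sortable_def using u u' iv by (intro exI[of _ u']) (auto simp: sorted_wrt_filter)
  then show ?thesis using that iv by blast
qed


section \<open>Joins and meets in the weak order\<close>

definition is_join :: "'a \<Rightarrow> 'a \<Rightarrow> 'a \<Rightarrow> bool" where
  "is_join x y z \<longleftrightarrow> z \<in> carrier W \<and> inv_roots x \<subseteq> inv_roots z \<and> inv_roots y \<subseteq> inv_roots z \<and>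
     (\<forall>u\<in>carrier W. inv_roots x \<subseteq> inv_roots u \<longrightarrow> inv_roots y \<subseteq> inv_roots u \<longrightarrow> inv_roots z \<subseteq> inv_roots u)"

definition is_meet :: "'a \<Rightarrow> 'a \<Rightarrow> 'a \<Rightarrow> bool" where
  "is_meet x y z \<longleftrightarrow> z \<in> carrier W \<and> inv_roots z \<subseteq> inv_roots x \<and> inv_roots z \<subseteq> inv_roots y \<and>
     (\<forall>u\<in>carrier W. inv_roots u \<subseteq> inv_roots x \<longrightarrow> inv_roots u \<subseteq> inv_roots y \<longrightarrow> inv_roots u \<subseteq> inv_roots z)"

lemma is_join_sym: "is_join x y z \<longleftrightarrow> is_join y x z"
  and is_meet_sym: "is_meet x y z \<longleftrightarrow> is_meet y x z"
  by (auto simp: is_join_def is_meet_def)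

lemma inv_roots_supported:
  assumes "u \<in> carrier W" "J \<subseteq> S" "\<And>j. j \<in> J \<Longrightarrow> simple_root j \<in> inv_roots u"
    "\<beta> \<in> pos_roots" "supported J \<beta>"
  shows "\<beta> \<in> inv_roots u"
proof -
  have "\<forall>t. 0 \<le> (- 1) * act (inv u) \<beta> t"
  proof (rule act_supported_sign[OF _ finite_subset[OF assms(2) finite_S] assms(5)
        pos_rootD(2)[OF assms(4)]])
    show "\<forall>t. 0 \<le> (- 1) * act (inv u) (simple_root j) t" if "j \<in> J" for j
      using assms(3)[OF that] by (simp add: inv_roots_def)
  qed (use assms(1) in simp)
  then show ?thesis using assms(4) by (simp add: inv_roots_def)
qed

text \<open>An upper bound of \<open>s\<close> and \<open>t\<close> has all positive roots in the span of the two simple roots as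
  inversions, so its parabolic part is the same for all upper bounds.\<close>

lemma join_of_simples:
  assumes "s \<in> S" "t \<in> S" "z \<in> carrier W" "simple_root s \<in> inv_roots z" "simple_root t \<in> inv_roots z"
  shows "\<exists>d. is_join s t d \<and> (\<forall>\<beta>\<in>inv_roots d. supported {s, t} \<beta>)"
proof -
  obtain d where d: "d \<in> carrier W" "inv_roots d = {\<beta> \<in> inv_roots z. supported {s, t} \<beta>}"
    using parabolic_part[of z "{s, t}"] assms by auto
  have "inv_roots d \<subseteq> inv_roots u"
    if "u \<in> carrier W" "simple_root s \<in> inv_roots u" "simple_root t \<in> inv_roots u" for u
    using inv_roots_supported[of u "{s, t}"] that assms d inv_roots_pos by auto
  then have "is_join s t d"
    using d assms by (auto simp: is_join_def inv_roots_S supported_simple_root)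
  then show ?thesis using d by blast
qed

lemma is_join_S_mult:
  assumes "s \<in> S" "x \<in> carrier W" "y \<in> carrier W" "simple_root s \<in> inv_roots x" "simple_root s \<in> inv_roots y"
    "is_join (s \<otimes> x) (s \<otimes> y) j" "simple_root s \<notin> inv_roots j"
  shows "is_join x y (s \<otimes> j)"
proof -
  have j: "j \<in> carrier W" "inv_roots (s \<otimes> x) \<subseteq> inv_roots j" "inv_roots (s \<otimes> y) \<subseteq> inv_roots j"
    using assms(6) by (auto simp: is_join_def)
  have x: "s \<otimes> x \<in> carrier W" "simple_root s \<notin> inv_roots (s \<otimes> x)" "s \<otimes> (s \<otimes> x) = x"
    and y: "s \<otimes> y \<in> carrier W" "simple_root s \<notin> inv_roots (s \<otimes> y)" "s \<otimes> (s \<otimes> y) = y"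
    using descent_mult assms by blast+
  have "inv_roots x \<subseteq> inv_roots (s \<otimes> j)" "inv_roots y \<subseteq> inv_roots (s \<otimes> j)"
    using S_mult_subset_iff[OF assms(1) x(1) j(1) x(2) assms(7)] j x(3)
      S_mult_subset_iff[OF assms(1) y(1) j(1) y(2) assms(7)] y(3) by simp_all
  moreover have "inv_roots (s \<otimes> j) \<subseteq> inv_roots u"
    if u: "u \<in> carrier W" "inv_roots x \<subseteq> inv_roots u" "inv_roots y \<subseteq> inv_roots u" for u
  proof -
    have su: "simple_root s \<in> inv_roots u" using u assms by blast
    note du = descent_mult[OF assms(1) u(1) su]
    have "inv_roots (s \<otimes> x) \<subseteq> inv_roots (s \<otimes> u)" "inv_roots (s \<otimes> y) \<subseteq> inv_roots (s \<otimes> u)"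
      using S_mult_subset_iff_descent su u assms by blast+
    then have "inv_roots j \<subseteq> inv_roots (s \<otimes> u)" using assms(6) du(1) by (simp add: is_join_def)
    then show ?thesis using S_mult_subset_iff[OF assms(1) j(1) du(1) assms(7) du(2)] du(3) by simp
  qed
  ultimately show ?thesis using j assms S_carrier by (simp add: is_join_def)
qed

text \<open>The induction is on the length of the upper bound \<open>z\<close>. If some simple reflection is below both
  elements, it can be removed from all three. Otherwise choose \<open>s\<close> below \<open>x\<close> and \<open>t\<close> below \<open>y\<close>. The
  join \<open>d\<close> of \<open>s\<close> and \<open>t\<close> is below every upper bound of \<open>x\<close> and \<open>y\<close>, so \<open>x\<close> and \<open>y\<close> may be replaced
  by their joins with \<open>d\<close>; here \<open>x\<close> and \<open>d\<close> are both above \<open>s\<close>, \<open>y\<close> and \<open>d\<close> are both above \<open>t\<close>, and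
  the two new elements are both above \<open>d\<close>.\<close>

lemma ex_join:
  assumes "z \<in> carrier W" "x \<in> carrier W" "y \<in> carrier W"
    "inv_roots x \<subseteq> inv_roots z" "inv_roots y \<subseteq> inv_roots z"
  shows "\<exists>j. is_join x y j"
  using assms
proof (induction "len z" arbitrary: x y z rule: less_induct)
  case less
  have common: "\<exists>j. is_join v w j"
    if c: "v \<in> carrier W" "w \<in> carrier W" "inv_roots v \<subseteq> inv_roots z" "inv_roots w \<subseteq> inv_roots z"
      "s \<in> S" "simple_root s \<in> inv_roots v" "simple_root s \<in> inv_roots w" for v w s
  proof -
    have sz: "simple_root s \<in> inv_roots z" using c by blast
    note dz = descent_mult[OF c(5) less.prems(1) sz]
    have sub: "inv_roots (s \<otimes> v) \<subseteq> inv_roots (s \<otimes> z)" "inv_roots (s \<otimes> w) \<subseteq> inv_roots (s \<otimes> z)"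
      using S_mult_subset_iff_descent sz c less.prems(1) by blast+
    obtain j where j: "is_join (s \<otimes> v) (s \<otimes> w) j"
      using less.hyps[of "s \<otimes> z" "s \<otimes> v" "s \<otimes> w"] sub dz len_S_mult_descent[OF c(5) less.prems(1) sz]
        c S_carrier by auto
    then have "inv_roots j \<subseteq> inv_roots (s \<otimes> z)" using sub dz by (auto simp: is_join_def)
    then have "simple_root s \<notin> inv_roots j" using dz by blast
    then show ?thesis using is_join_S_mult j c by blast
  qed
  show ?case
  proof (cases "x = \<one> \<or> y = \<one>")
    case True
    then show ?thesis using less.prems by (auto simp: is_join_def)
  next
    case False
    obtain s t where st: "s \<in> S" "simple_root s \<in> inv_roots x" "t \<in> S" "simple_root t \<in> inv_roots y"
      using ex_descent False less.prems by meson
    obtain d where d: "is_join s t d" using join_of_simples[OF st(1,3) less.prems(1)] st(2,4) less.prems(4,5) by (meson subsetD)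
    have dz: "d \<in> carrier W" "inv_roots d \<subseteq> inv_roots z" "simple_root s \<in> inv_roots d" "simple_root t \<in> inv_roots d"
      using d st less.prems by (auto simp: is_join_def inv_roots_S)
    obtain x' where x': "is_join x d x'" using common[of x d s] st dz less.prems by blast
    obtain y' where y': "is_join y d y'" using common[of y d t] st dz less.prems by blast
    have xy: "x' \<in> carrier W" "inv_roots x' \<subseteq> inv_roots z" "y' \<in> carrier W" "inv_roots y' \<subseteq> inv_roots z"
      "inv_roots d \<subseteq> inv_roots x'" "inv_roots d \<subseteq> inv_roots y'"
      using x' y' dz less.prems by (auto simp: is_join_def)
    obtain j where j: "is_join x' y' j" using common[of x' y' s] xy dz st by blast
    have ub: "inv_roots d \<subseteq> inv_roots u"
      if "u \<in> carrier W" "inv_roots x \<subseteq> inv_roots u" "inv_roots y \<subseteq> inv_roots u" for u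
      using that st d by (auto simp: is_join_def inv_roots_S)
    have "is_join x y j"
      unfolding is_join_def
    proof (intro conjI ballI impI)
      show "j \<in> carrier W" "inv_roots x \<subseteq> inv_roots j" "inv_roots y \<subseteq> inv_roots j"
        using j x' y' by (auto simp: is_join_def)
      fix u assume u: "u \<in> carrier W" "inv_roots x \<subseteq> inv_roots u" "inv_roots y \<subseteq> inv_roots u"
      then have "inv_roots x' \<subseteq> inv_roots u" "inv_roots y' \<subseteq> inv_roots u"
        using x' y' ub[OF u] unfolding is_join_def by blast+
      then show "inv_roots j \<subseteq> inv_roots u" using j u unfolding is_join_def by blast
    qed
    then show ?thesis by blast
  qed
qed

lemma is_join_unique: "is_join x y z \<Longrightarrow> is_join x y z' \<Longrightarrow> z = z'"
  by (rule inv_roots_inj) (auto simp: is_join_def)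

text \<open>The join \<open>j\<close> of \<open>s x\<close> and \<open>s y\<close> exists below \<open>s z\<close>, so it is not above \<open>s\<close>, and \<open>s j\<close> is the join of
  \<open>x\<close> and \<open>y\<close>.\<close>

lemma is_join_descent:
  assumes "s \<in> S" "x \<in> carrier W" "y \<in> carrier W" "simple_root s \<in> inv_roots x" "simple_root s \<in> inv_roots y"
    "is_join x y z"
  shows "is_join (s \<otimes> x) (s \<otimes> y) (s \<otimes> z)"
proof -
  have z: "z \<in> carrier W" "inv_roots x \<subseteq> inv_roots z" "inv_roots y \<subseteq> inv_roots z"
    using assms by (auto simp: is_join_def)
  then have sz: "simple_root s \<in> inv_roots z" using assms by blast
  note dz = descent_mult[OF assms(1) z(1) sz]
  have sub: "inv_roots (s \<otimes> x) \<subseteq> inv_roots (s \<otimes> z)" "inv_roots (s \<otimes> y) \<subseteq> inv_roots (s \<otimes> z)"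
    using S_mult_subset_iff_descent sz assms z by blast+
  then obtain j where j: "is_join (s \<otimes> x) (s \<otimes> y) j"
    using ex_join[of "s \<otimes> z" "s \<otimes> x" "s \<otimes> y"] dz assms S_carrier by auto
  then have jc: "j \<in> carrier W" "inv_roots j \<subseteq> inv_roots (s \<otimes> z)" using sub dz by (auto simp: is_join_def)
  then have "simple_root s \<notin> inv_roots j" using dz by blast
  then have "is_join x y (s \<otimes> j)" using is_join_S_mult j assms by blast
  then have "s \<otimes> j = z" using is_join_unique assms by blast
  then have "s \<otimes> z = j" using jc assms by auto
  then show ?thesis using j by simp
qed

lemma is_meet_descent:
  assumes "s \<in> S" "x \<in> carrier W" "y \<in> carrier W" "simple_root s \<in> inv_roots x" "simple_root s \<in> inv_roots y"
    "is_meet x y z"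
  shows "simple_root s \<in> inv_roots z" "is_meet (s \<otimes> x) (s \<otimes> y) (s \<otimes> z)"
proof -
  have z: "z \<in> carrier W" "inv_roots z \<subseteq> inv_roots x" "inv_roots z \<subseteq> inv_roots y"
    using assms by (auto simp: is_meet_def)
  have "inv_roots s \<subseteq> inv_roots x" "inv_roots s \<subseteq> inv_roots y" using assms by (simp_all add: inv_roots_S)
  then have "inv_roots s \<subseteq> inv_roots z" using assms(1,6) S_carrier unfolding is_meet_def by blast
  then show sz: "simple_root s \<in> inv_roots z" using assms(1) by (simp add: inv_roots_S)
  have d: "s \<otimes> x \<in> carrier W" "simple_root s \<notin> inv_roots (s \<otimes> x)" "s \<otimes> (s \<otimes> x) = x"
    "s \<otimes> y \<in> carrier W" "simple_root s \<notin> inv_roots (s \<otimes> y)" "s \<otimes> (s \<otimes> y) = y"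
    "s \<otimes> z \<in> carrier W" "simple_root s \<notin> inv_roots (s \<otimes> z)" "s \<otimes> (s \<otimes> z) = z"
    using descent_mult assms z sz by blast+
  have "inv_roots u \<subseteq> inv_roots (s \<otimes> z)"
    if u: "u \<in> carrier W" "inv_roots u \<subseteq> inv_roots (s \<otimes> x)" "inv_roots u \<subseteq> inv_roots (s \<otimes> y)" for u
  proof -
    have su: "simple_root s \<notin> inv_roots u" using u d by blast
    have "inv_roots (s \<otimes> u) \<subseteq> inv_roots x" "inv_roots (s \<otimes> u) \<subseteq> inv_roots y"
      using S_mult_subset_iff[OF assms(1) u(1) d(1) su d(2)] S_mult_subset_iff[OF assms(1) u(1) d(4) su d(5)]
        u d by simp_all
    then have "inv_roots (s \<otimes> u) \<subseteq> inv_roots z"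
      using assms(1,6) u S_carrier by (simp add: is_meet_def)
    then show ?thesis using S_mult_subset_iff[OF assms(1) u(1) d(7) su d(8)] d by simp
  qed
  moreover have "inv_roots (s \<otimes> z) \<subseteq> inv_roots (s \<otimes> x)" "inv_roots (s \<otimes> z) \<subseteq> inv_roots (s \<otimes> y)"
    using S_mult_subset_iff_descent sz assms z by blast+
  ultimately show "is_meet (s \<otimes> x) (s \<otimes> y) (s \<otimes> z)" using d by (simp add: is_meet_def)
qed

section \<open>Closure of the sortable elements under joins and meets\<close>

text \<open>Such an element is an alternating product of \<open>s\<close> and \<open>t\<close> that starts with \<open>s\<close>, if not empty.\<close>

lemma omega_sortable_rank_two:
  assumes "s \<in> S" "t \<in> S" "s \<noteq> t" "v \<in> carrier W" "\<forall>\<beta>\<in>inv_roots v. supported {s, t} \<beta>"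
    "simple_root t \<notin> inv_roots v"
  shows "omega_sortable [s, t] v"
  using assms
proof (induction "len v" arbitrary: v s t rule: less_induct)
  case less
  show ?case
  proof (cases "v = \<one>")
    case True
    then show ?thesis by (simp add: omega_sortable_one)
  next
    case False
    obtain r where r: "r \<in> S" "simple_root r \<in> inv_roots v" using ex_descent False less.prems by blast
    then have "supported {s, t} (simple_root r)" using less.prems by blast
    then have "r \<in> {s, t}" by (metis simple_root_def supported_def zero_neq_one)
    then have sv: "simple_root s \<in> inv_roots v" using r less.prems by auto
    note d = descent_mult[OF less.prems(1,4) sv]
    have "inv_roots v = insert (simple_root s) (reflect s ` inv_roots (s \<otimes> v))"
      using inv_roots_ascent[OF less.prems(1) d(1,2)] d(3) by simp
    then have "\<forall>\<beta>\<in>inv_roots (s \<otimes> v). supported {t, s} \<beta>"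
      using less.prems(5) by (auto simp: supported_reflect insert_commute)
    then have "omega_sortable ([t] @ [s]) (s \<otimes> v)"
      using less.hyps[of "s \<otimes> v" t s] less.prems d len_S_mult_descent[OF less.prems(1,4) sv] by simp
    then have "omega_sortable (s # [t]) (s \<otimes> (s \<otimes> v))"
      using less.prems d by (intro omega_sortable_prepend) auto
    then show ?thesis using d by simp
  qed
qed

lemma omega_sortable_append: "omega_sortable d w \<Longrightarrow> distinct (c @ d) \<Longrightarrow> omega_sortable (c @ d) w"
  by (induction c) (use omega_sortable_insert[of "[]"] in auto)

lemma is_join_len:
  assumes "is_join x y z" "u \<in> carrier W" "inv_roots x \<subseteq> inv_roots u" "inv_roots y \<subseteq> inv_roots u"
  shows "len z \<le> len u"
  using assms card_inv_roots[of u] card_inv_roots[of z] card_mono[of "inv_roots u" "inv_roots z"]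
  by (auto simp: is_join_def)

text \<open>Let \<open>c = s d\<close>. If both elements are above \<open>s\<close>, cancel \<open>s\<close> and rotate \<open>c\<close>; if neither is, then both
  are sortable for \<open>d\<close>. Let \<open>x\<close> be above \<open>s\<close> and \<open>y\<close> not. Once the join \<open>p\<close> of \<open>s\<close> and \<open>y\<close> is
  known to be sortable, \<open>x\<close> and \<open>p\<close> are both above \<open>s\<close> and have the same join as \<open>x\<close> and \<open>y\<close>.

  The element \<open>p\<close> is shown to be sortable for the rotated word \<open>d s\<close> first. Let \<open>r\<close> be the first
  letter of \<open>d = r e\<close>. If \<open>y\<close> is not above \<open>r\<close>, then \<open>r\<close> can be dropped from the word. If it is, then
  \<open>r p\<close> is the join of \<open>r y\<close> and \<open>r q\<close>, where \<open>q\<close> is the join of \<open>r\<close> and \<open>s\<close>; both are sortable for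
  \<open>e s r\<close>, and \<open>r p\<close> is shorter than \<open>p\<close>. Having \<open>s\<close> as final letter in \<open>d s\<close>, one may delete it from
  \<open>p\<close> on the left without rotating the word. So \<open>s p\<close> is sortable for \<open>d s\<close>, and \<open>p\<close> is sortable
  for \<open>s d\<close>.\<close>

theorem omega_sortable_join:
  assumes "distinct c" "set c \<subseteq> S" "omega_sortable c x" "omega_sortable c y" "is_join x y z"
  shows "omega_sortable c z"
  using assms
proof (induction "(length c, len z)" arbitrary: c x y z
    rule: wf_induct_rule[OF wf_lex_prod[OF wf_less_than wf_less_than]])
  case (1 c z x y)
  have IH: "omega_sortable c' z'"
    if "length c' < length c \<or> length c' = length c \<and> len z' < len z" "distinct c'" "set c' \<subseteq> S"
      "omega_sortable c' x'" "omega_sortable c' y'" "is_join x' y' z'" for c' x' y' z'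
    using "1.hyps"[of c' z' x' y'] that by auto
  have xyz: "x \<in> carrier W" "y \<in> carrier W" "z \<in> carrier W" "inv_roots x \<subseteq> inv_roots z" "inv_roots y \<subseteq> inv_roots z"
    using "1.prems" omega_sortable_closed by (auto simp: is_join_def)
  show ?case
  proof (cases c)
    case Nil
    have "x = \<one>" "y = \<one>" using "1.prems" Nil omega_sortable_Nil by auto
    then have "inv_roots z \<subseteq> inv_roots \<one>" using "1.prems"(5) unfolding is_join_def by blast
    then have "z = \<one>" using inv_roots_empty[OF xyz(3)]  by simp
    then show ?thesis by (simp add: omega_sortable_one)
  next
    case (Cons s d)
    have c: "distinct (s # d)" "set (s # d) \<subseteq> S" and s: "s \<in> S" using "1.prems" Cons by auto
    have rot: "distinct (d @ [s])" "set (d @ [s]) \<subseteq> S" using c by auto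
    have common: "omega_sortable (s # d) z"
      if v: "omega_sortable (s # d) v" "omega_sortable (s # d) w" "is_join v w z"
        "simple_root s \<in> inv_roots v" "simple_root s \<in> inv_roots w" for v w
    proof -
      have vc: "v \<in> carrier W" "w \<in> carrier W" using v omega_sortable_closed by auto
      have sz: "simple_root s \<in> inv_roots z" using v by (auto simp: is_join_def)
      note dz = descent_mult[OF s xyz(3) sz]
      have "omega_sortable (d @ [s]) (s \<otimes> z)"
      proof (rule IH)
        show "length (d @ [s]) < length c \<or> length (d @ [s]) = length c \<and> len (s \<otimes> z) < len z"
          using Cons len_S_mult_descent[OF s xyz(3) sz] by simp
        show "omega_sortable (d @ [s]) (s \<otimes> v)" "omega_sortable (d @ [s]) (s \<otimes> w)"
          using omega_sortable_left_mult c v by auto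
        show "is_join (s \<otimes> v) (s \<otimes> w) (s \<otimes> z)" using is_join_descent s vc v by blast
      qed (use rot in auto)
      then show ?thesis using omega_sortable_prepend[OF c] dz by metis
    qed
    have mixed: "omega_sortable (s # d) z"
      if v: "omega_sortable (s # d) v" "omega_sortable (s # d) w" "is_join v w z"
        "simple_root s \<in> inv_roots v" "simple_root s \<notin> inv_roots w" for v w
    proof -
      have vw: "v \<in> carrier W" "w \<in> carrier W" "inv_roots v \<subseteq> inv_roots z" "inv_roots w \<subseteq> inv_roots z"
        using v omega_sortable_closed by (auto simp: is_join_def)
      have w: "omega_sortable d w" using omega_sortable_no_descent[OF c v(2,5)] .
      have sz: "inv_roots s \<subseteq> inv_roots z" using v vw inv_roots_S s by auto
      obtain p where p: "is_join s w p" using ex_join[OF xyz(3) S_carrier[OF s] vw(2) sz vw(4)] by blast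
      have pc: "p \<in> carrier W" "simple_root s \<in> inv_roots p" "inv_roots w \<subseteq> inv_roots p"
        "inv_roots p \<subseteq> inv_roots z"
        using p s sz vw xyz by (auto simp: is_join_def inv_roots_S)
      have pz: "len p \<le> len z" using is_join_len p xyz sz vw by blast
      \<comment> \<open>Here \<open>s\<close> is final; only afterwards it is moved to the front.\<close>
      have "omega_sortable (d @ [s]) p"
      proof (cases d)
        case Nil
        then have "w = \<one>" using omega_sortable_Nil w by simp
        then have "is_join s w s" using S_carrier[OF s] by (simp add: is_join_def)
        then have "p = s" using is_join_unique p by blast
        then have "omega_sortable [s] p" using omega_sortable_simple s by simp
        then show ?thesis using Nil by simp
      next
        case (Cons r e)
        have r: "r \<in> S" "r \<noteq> s" using c Cons by auto
        have re: "distinct (r # e)" "set (r # e) \<subseteq> S" and res: "distinct (r # e @ [s])" "set (r # e @ [s]) \<subseteq> S"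
          using c Cons by auto
        show ?thesis
        proof (cases "simple_root r \<in> inv_roots w")
          case False
          have "omega_sortable e w" using omega_sortable_no_descent[OF re] w Cons False by simp
          then have "omega_sortable (e @ [s]) w" using omega_sortable_insert[of e "[]" w s] c Cons by simp
          moreover have "omega_sortable (e @ [s]) s" using omega_sortable_simple s by simp
          ultimately have "omega_sortable (e @ [s]) p"
            using IH[of "e @ [s]" p s w] p c \<open>c = s # d\<close> Cons by simp
          then show ?thesis using omega_sortable_insert[of "[]" "e @ [s]" p r] c Cons r(2) by simp
        next
          case True
          have rp: "simple_root r \<in> inv_roots p" using True pc by blast
          obtain q where q: "is_join r s q" "\<forall>\<beta>\<in>inv_roots q. supported {r, s} \<beta>"
            using join_of_simples[OF r(1) s pc(1) rp pc(2)] by blast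
          have qc: "q \<in> carrier W" "simple_root r \<in> inv_roots q" "inv_roots q \<subseteq> inv_roots p"
            using q(1) r s rp pc by (auto simp: is_join_def inv_roots_S)
          have "is_join q w p"
            using p q(1) pc(1,3) qc True r s by (auto simp: is_join_def inv_roots_S)
          then have j: "is_join (r \<otimes> q) (r \<otimes> w) (r \<otimes> p)"
            using is_join_descent r qc vw True by blast
          note dq = descent_mult[OF r(1) qc(1,2)] and dp = descent_mult[OF r(1) pc(1) rp]
          have "omega_sortable (e @ [r]) (r \<otimes> w)" using omega_sortable_left_mult[OF re] w Cons True by simp
          then have 1: "omega_sortable (e @ [s, r]) (r \<otimes> w)"
            using omega_sortable_insert[of e "[r]" _ s] c Cons r by simp
          have "inv_roots q = insert (simple_root r) (reflect r ` inv_roots (r \<otimes> q))"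
            using inv_roots_ascent[OF r(1) dq(1,2)] dq(3) by simp
          then have "\<forall>\<beta>\<in>inv_roots (r \<otimes> q). supported {s, r} \<beta>"
            using q(2) by (auto simp: supported_reflect insert_commute)
          then have "omega_sortable [s, r] (r \<otimes> q)" using omega_sortable_rank_two r s dq by auto
          then have 2: "omega_sortable (e @ [s, r]) (r \<otimes> q)" using omega_sortable_append[of "[s, r]"] c Cons r by simp
          have "omega_sortable (e @ [s, r]) (r \<otimes> p)"
          proof (rule IH[OF _ _ _ 2 1 j])
            show "length (e @ [s, r]) < length c \<or> length (e @ [s, r]) = length c \<and> len (r \<otimes> p) < len z"
              using \<open>c = s # d\<close> Cons len_S_mult_descent[OF r(1) pc(1) rp] pz by simp
          qed (use c Cons in auto)
          then have "omega_sortable (r # (e @ [s])) p"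
            using omega_sortable_prepend[OF res, of "r \<otimes> p"] dp by simp
          then show ?thesis using Cons by simp
        qed
      qed
      then have "omega_sortable (d @ [s]) (s \<otimes> p)" using omega_sortable_final_left_mult[OF c] pc by simp
      then have "omega_sortable (s # d) p" using omega_sortable_prepend[OF c] descent_mult[OF s pc(1,2)] by metis
      moreover have "is_join v p z"
        using v(3,4) p pc s vw xyz by (auto simp: is_join_def inv_roots_S)
      ultimately show ?thesis using common v pc by blast
    qed
    have "omega_sortable (s # d) z"
    proof (cases "simple_root s \<in> inv_roots x"; cases "simple_root s \<in> inv_roots y")
      assume "simple_root s \<in> inv_roots x" "simple_root s \<in> inv_roots y"
      then show ?thesis using common "1.prems" Cons by blast
    next
      assume "simple_root s \<in> inv_roots x" "simple_root s \<notin> inv_roots y"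
      then show ?thesis using mixed "1.prems" Cons by blast
    next
      assume "simple_root s \<notin> inv_roots x" "simple_root s \<in> inv_roots y"
      then show ?thesis using mixed is_join_sym "1.prems" Cons by blast
    next
      assume "simple_root s \<notin> inv_roots x" "simple_root s \<notin> inv_roots y"
      then have "omega_sortable d x" "omega_sortable d y" using omega_sortable_no_descent c "1.prems" Cons by auto
      then have "omega_sortable d z" using IH[of d z x y] "1.prems" Cons by simp
      then show ?thesis using omega_sortable_insert[of "[]" d z s] c by simp
    qed
    then show ?thesis using Cons by simp
  qed
qed

text \<open>Let \<open>c = s d\<close>. If both elements are above \<open>s\<close>, cancel \<open>s\<close> and rotate \<open>c\<close>. If one element
  \<open>w\<close> is not, then it lies in the parabolic subgroup generated by the letters of \<open>d\<close>, where it is sortable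
  for \<open>d\<close>. Its meet with the other element \<open>v\<close> equals its meet with the parabolic part of \<open>v\<close>, which is again sortable by
  \<open>omega_sortable_restrict\<close>.\<close>

theorem omega_sortable_meet:
  assumes "distinct c" "set c \<subseteq> S" "omega_sortable c x" "omega_sortable c y" "is_meet x y z"
  shows "omega_sortable c z"
  using assms
proof (induction "(length c, len x)" arbitrary: c x y z
    rule: wf_induct_rule[OF wf_lex_prod[OF wf_less_than wf_less_than]])
  case (1 c x y z)
  have IH: "omega_sortable c' z'"
    if "length c' < length c \<or> length c' = length c \<and> len x' < len x" "distinct c'" "set c' \<subseteq> S"
      "omega_sortable c' x'" "omega_sortable c' y'" "is_meet x' y' z'" for c' x' y' z'
    using "1.hyps"[of c' x' y' z'] that by auto
  have xyz: "x \<in> carrier W" "y \<in> carrier W" "z \<in> carrier W" "inv_roots z \<subseteq> inv_roots x" "inv_roots z \<subseteq> inv_roots y"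
    using "1.prems" omega_sortable_closed by (auto simp: is_meet_def)
  show ?case
  proof (cases c)
    case Nil
    have "x = \<one>" using "1.prems" Nil omega_sortable_Nil by auto
    then have "z = \<one>" using inv_roots_empty[OF xyz(3)] xyz(4) by simp
    then show ?thesis by (simp add: omega_sortable_one)
  next
    case (Cons s d)
    have c: "distinct (s # d)" "set (s # d) \<subseteq> S" and s: "s \<in> S" using "1.prems" Cons by auto
    have mixed: "omega_sortable (s # d) z"
      if v: "omega_sortable (s # d) v" "omega_sortable (s # d) w" "is_meet v w z" "simple_root s \<notin> inv_roots w" for v w
    proof -
      have w: "omega_sortable d w" using omega_sortable_no_descent[OF c v(2,4)] .
      obtain p where p: "omega_sortable (s # d) p" "inv_roots p = {\<beta> \<in> inv_roots v. supported (set d) \<beta>}"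
        using omega_sortable_restrict[OF v(1), of "set d"] c by auto
      have "\<not> supported (set d) (simple_root s)" using c by (auto simp: supported_def simple_root_def)
      then have "omega_sortable d p" using omega_sortable_no_descent[OF c p(1)] p(2) by simp
      moreover have "is_meet p w z"
        using v(3) p(2) omega_sortable_supported[OF w] unfolding is_meet_def by blast
      ultimately have "omega_sortable d z" using IH[of d p w z] w c Cons by simp
      then show ?thesis using omega_sortable_insert[of "[]" d z s] c by simp
    qed
    have "omega_sortable (s # d) z"
    proof (cases "simple_root s \<in> inv_roots x \<and> simple_root s \<in> inv_roots y")
      case True
      have sz: "simple_root s \<in> inv_roots z" and m: "is_meet (s \<otimes> x) (s \<otimes> y) (s \<otimes> z)"
        using is_meet_descent s xyz True "1.prems" by blast+
      note dz = descent_mult[OF s xyz(3) sz]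
      have "omega_sortable (d @ [s]) (s \<otimes> z)"
      proof (rule IH[OF _ _ _ _ _ m])
        show "length (d @ [s]) < length c \<or> length (d @ [s]) = length c \<and> len (s \<otimes> x) < len x"
          using Cons len_S_mult_descent[OF s xyz(1)] True by simp
        show "omega_sortable (d @ [s]) (s \<otimes> x)" "omega_sortable (d @ [s]) (s \<otimes> y)"
          using omega_sortable_left_mult c "1.prems" Cons True by auto
      qed (use c in auto)
      then show ?thesis using omega_sortable_prepend[OF c] dz by metis
    next
      case False
      then show ?thesis using mixed[of x y] mixed[of y x] is_meet_sym "1.prems" Cons by blast
    qed
    then show ?thesis using Cons by simp
  qed
qed

end

section \<open>Sorting words\<close>

lemma map_Suc_pred: "0 \<notin> set qs \<Longrightarrow> map Suc (map (\<lambda>i. i - 1) qs) = qs"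
  by (induction qs) auto

lemma sorted_nat_list_cases:
  fixes qs :: "nat list"
  assumes "sorted_wrt (<) qs"
  obtains q where "qs = map Suc q" "sorted_wrt (<) q" | q where "qs = 0 # map Suc q" "sorted_wrt (<) q"
proof (cases "0 \<in> set qs")
  case False
  then have q: "qs = map Suc (map (\<lambda>i. i - 1) qs)" by (rule map_Suc_pred[symmetric])
  then have "sorted_wrt (<) (map Suc (map (\<lambda>i. i - 1) qs))" using assms by simp
  then have "sorted_wrt (<) (map (\<lambda>i. i - 1) qs)" by (simp add: sorted_wrt_map)
  then show ?thesis using that(1) q by blast
next
  case True
  then obtain x xs where x: "qs = x # xs" by (cases qs) auto
  have "x = 0" "0 \<notin> set xs" using True x assms by auto
  have q: "xs = map Suc (map (\<lambda>i. i - 1) xs)"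
    using \<open>0 \<notin> set xs\<close> by (rule map_Suc_pred[symmetric])
  then have "sorted_wrt (<) (map Suc (map (\<lambda>i. i - 1) xs))" using assms x by simp
  then have "sorted_wrt (<) (map (\<lambda>i. i - 1) xs)" by (simp add: sorted_wrt_map)
  then show ?thesis using that(2) q x \<open>x = 0\<close> by blast
qed

lemma lexord_map_Suc:
  "(ps, qs) \<in> lexord {(i, j). i < j} \<Longrightarrow> (map Suc ps, map Suc qs) \<in> lexord {(i, j). i < j}"
proof (induction ps arbitrary: qs)
  case Nil
  then show ?case by (cases qs) auto
next
  case (Cons p ps)
  then show ?case by (cases qs) auto
qed

text \<open>The condition on the blocks of a sorting word in a form that does not mention the dividers. It
  survives a shift of all positions by one, which corresponds to a rotation of the word.\<close>

definition nested :: "nat \<Rightarrow> nat list \<Rightarrow> bool" where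
  "nested n ps \<longleftrightarrow> (\<forall>i. i + n \<in> set ps \<longrightarrow> i \<in> set ps)"

lemma nested_mod:
  assumes "nested n ps" "i \<in> set ps"
  shows "i mod n \<in> set ps"
proof -
  have "k * n + r \<in> set ps \<Longrightarrow> r \<in> set ps" for k r
  proof (induction k)
    case (Suc k)
    have "(k * n + r) + n \<in> set ps" using Suc.prems by (simp add: algebra_simps)
    then show ?case using Suc.IH assms(1) unfolding nested_def by blast
  qed simp
  from this[of "i div n" "i mod n"] show ?thesis using assms(2) by simp
qed

lemma c_infinity_rotate: "c_infinity (c @ [s]) i = c_infinity (s # c) (Suc i)"
proof -
  have "rotate1 (s # c) ! (i mod length (s # c)) = (s # c) ! (Suc (i mod length (s # c)) mod length (s # c))"
    by (rule nth_rotate1) simp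
  then show ?thesis by (simp add: c_infinity_def mod_Suc_eq)
qed

lemma c_infinity_0: "c_infinity (s # c) 0 = s"
  by (simp add: c_infinity_def)

text \<open>The letters being distinct, the same letter in the previous block sits exactly one length of
  \<open>a\<close> earlier.\<close>

lemma antimono_block_letters:
  assumes "distinct a"
  shows "antimono (block_letters a ps) \<longleftrightarrow> nested (length a) ps"
proof (cases "a = []")
  case True
  have "antimono (block_letters a ps)"
    using True by (intro decseq_SucI) (auto simp: block_letters_def)
  then show ?thesis using True by (simp add: nested_def)
next
  case False
  then have n: "0 < length a" by simp
  show ?thesis
  proof
    assume am: "antimono (block_letters a ps)"
    show "nested (length a) ps"
      unfolding nested_def
    proof (intro allI impI)
      fix i assume i: "i + length a \<in> set ps"
      have "c_infinity a (i + length a) \<in> block_letters a ps (Suc (i div length a))"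
        using i n by (auto simp: block_letters_def)
      then have "c_infinity a (i + length a) \<in> block_letters a ps (i div length a)"
        using antimonoD[OF am, of "i div length a" "Suc (i div length a)"] by auto
      then obtain j where j: "j \<in> set ps" "j div length a = i div length a"
        "c_infinity a (i + length a) = c_infinity a j" by (auto simp: block_letters_def)
      then have "i mod length a = j mod length a"
        using assms n by (simp add: c_infinity_def nth_eq_iff_index_eq)
      then have "i = j" using j(2) by (metis div_mod_decomp)
      then show "i \<in> set ps" using j by simp
    qed
  next
    assume ne: "nested (length a) ps"
    show "antimono (block_letters a ps)"
    proof (intro decseq_SucI subsetI)
      fix k x assume "x \<in> block_letters a ps (Suc k)"
      then obtain i where i: "i \<in> set ps" "i div length a = Suc k" "x = c_infinity a i"
        by (auto simp: block_letters_def)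
      define j where "j = i - length a"
      have "length a \<le> i" using i(2) n by (metis div_less not_less zero_less_Suc less_irrefl)
      then have ij: "i = j + length a" by (simp add: j_def)
      have "j \<in> set ps" using ne i ij unfolding nested_def by blast
      moreover have "j div length a = k" using i(2) n unfolding ij by simp
      moreover have "x = c_infinity a j" using i(3) unfolding ij by (simp add: c_infinity_def)
      ultimately show "x \<in> block_letters a ps k" by (auto simp: block_letters_def)
    qed
  qed
qed

context coxeter begin

lemma reduced_word_for_iff: "reduced_word_for W S u w \<longleftrightarrow> reduced u \<and> val u = w"
  by (auto simp: reduced_word_for_def reduced_def)

lemma reduced_letter_inv_root:
  assumes "reduced u" "s \<in> set u"
  shows "\<exists>\<beta>\<in>inv_roots (val u). \<beta> s \<noteq> 0"
proof -
  obtain u1 u2 where u12: "u = u1 @ s # u2" "s \<notin> set u1" using assms by (metis split_list_first)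
  let ?x = "act_word u1 (simple_root s)"
  have "?x \<in> inv_roots (val u)"
    using set_root_seq[OF assms(1)] u12 by (auto simp: root_seq_append)
  moreover have "?x s = simple_root s s"
    using u12 assms(1) by (intro act_word_outside) (auto simp: reduced_def)
  ultimately show ?thesis by (intro bexI[of _ ?x]) (auto simp: simple_root_def)
qed

text \<open>The positions are shifted down by one and \<open>a\<close> is rotated. If position \<open>0\<close> was used, this is
  \<open>omega_sortable_prepend\<close>. If it was not, then by nestedness the first letter of \<open>a\<close> does not
  occur at all, and its place in the word is irrelevant.\<close>

lemma nested_word_omega_sortable:
  assumes "distinct a" "set a = S" "sorted_wrt (<) ps" "nested (length a) ps"
    "reduced (map (c_infinity a) ps)"
  shows "omega_sortable a (val (map (c_infinity a) ps))"
  using assms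
proof (induction "sum_list (map Suc ps)" arbitrary: a ps rule: less_induct)
  case less
  show ?case
  proof (cases "ps = []")
    case True
    then show ?thesis by (simp add: omega_sortable_one)
  next
    case False
    have "a \<noteq> []" using less.prems(2,5) False by (cases ps) (auto simp: reduced_def)
    then obtain s c where a: "a = s # c" by (cases a) auto
    have sc: "distinct (s # c)" "set (s # c) \<subseteq> S" and s: "s \<in> S" using less.prems a by auto
    have rot: "distinct (c @ [s])" "set (c @ [s]) = S" using less.prems a by auto
    have letters: "map (c_infinity a) (map Suc q) = map (c_infinity (c @ [s])) q" for q
      unfolding a by (simp add: c_infinity_rotate)
    from less.prems(3) show ?thesis
    proof (cases rule: sorted_nat_list_cases)
      case (1 q)
      have ne: "nested (length (c @ [s])) q"
        unfolding nested_def
      proof (intro allI impI)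
        fix i assume "i + length (c @ [s]) \<in> set q"
        then have "Suc i + length a \<in> set ps" using 1 a by auto
        then have "Suc i \<in> set ps" using less.prems(4) unfolding nested_def by blast
        then show "i \<in> set q" using 1 by auto
      qed
      have red: "reduced (map (c_infinity (c @ [s])) q)" using less.prems(5) 1(1) letters by metis
      have "sum_list (map Suc q) < sum_list (map Suc ps)"
        using 1(1) False by (simp add: sum_list_Suc comp_def)
      then have o: "omega_sortable (c @ [s]) (val (map (c_infinity (c @ [s])) q))"
        using less.hyps 1(2) rot ne red by blast
      have "s \<notin> set (map (c_infinity a) ps)"
      proof
        assume "s \<in> set (map (c_infinity a) ps)"
        then obtain i where i: "i \<in> set ps" "c_infinity a i = s" by auto
        then have "a ! (i mod length a) = a ! 0" by (simp add: c_infinity_def a)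
        then have "i mod length a = 0" using nth_eq_iff_index_eq[OF less.prems(1), of "i mod length a" 0] a by simp
        then have "0 \<in> set ps" using nested_mod[OF less.prems(4) i(1)] by simp
        then show False using 1 by auto
      qed
      then have "s \<notin> set (map (c_infinity (c @ [s])) q)" unfolding 1(1) letters .
      moreover have "set (map (c_infinity (c @ [s])) q) \<subseteq> S" using red by (auto simp: reduced_def)
      ultimately have "\<beta> s = 0" if "\<beta> \<in> inv_roots (val (map (c_infinity (c @ [s])) q))" for \<beta>
        using that root_seq_coordinate unfolding set_root_seq[OF red, symmetric] by blast
      then have "omega_sortable c (val (map (c_infinity (c @ [s])) q))"
        using omega_sortable_drop_unused[of c s "[]"] o by auto
      then show ?thesis using omega_sortable_insert[of "[]" c _ s] sc 1(1) letters a by (metis append_Nil distinct.simps(2))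
    next
      case (2 q)
      have ne: "nested (length (c @ [s])) q"
        unfolding nested_def
      proof (intro allI impI)
        fix i assume "i + length (c @ [s]) \<in> set q"
        then have "Suc i + length a \<in> set ps" using 2 a by auto
        then have "Suc i \<in> set ps" using less.prems(4) unfolding nested_def by blast
        then show "i \<in> set q" using 2 by auto
      qed
      have word: "map (c_infinity a) ps = s # map (c_infinity (c @ [s])) q"
        using letters[of q] 2(1) a c_infinity_0 by simp
      have red: "reduced (s # map (c_infinity (c @ [s])) q)" using less.prems(5) word by simp
      have "sum_list (map Suc q) < sum_list (map Suc ps)"
        using 2(1) by (simp add: sum_list_Suc comp_def)
      then have o: "omega_sortable (c @ [s]) (val (map (c_infinity (c @ [s])) q))"
        using less.hyps 2(2) rot ne reduced_ConsD(2)[OF red] by blast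
      then have "omega_sortable (s # c) (s \<otimes> val (map (c_infinity (c @ [s])) q))"
        using omega_sortable_prepend[OF sc] reduced_ConsD(3)[OF red] by blast
      then show ?thesis unfolding word by (simp add: a)
    qed
  qed
qed

text \<open>The lexicographically first word is greedy: it uses the first letter of \<open>a\<close> if and only if this
  letter is below \<open>w\<close>. In both cases \<open>a\<close> is rotated and the positions are shifted. The measure
  decreases because either \<open>w\<close> becomes shorter, which outweighs the second summand, or the first
  letter below \<open>w\<close> moves closer to the front.\<close>

lemma omega_sortable_sorting_word:
  assumes "distinct a" "set a = S" "omega_sortable a w"
  shows "\<exists>ps. c_sorting_word W S a ps w \<and> nested (length a) ps"
  using assms
proof (induction "len w + length (takeWhile (\<lambda>s. simple_root s \<notin> inv_roots w) a) + length a * len w"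
    arbitrary: a w rule: less_induct)
  case less
  have wc: "w \<in> carrier W" using less.prems omega_sortable_closed by blast
  show ?case
  proof (cases "w = \<one>")
    case True
    have "qs = []" if "reduced_subword_for W S a qs \<one>" for qs
      using that by (auto simp: reduced_subword_for_def reduced_word_for_def)
    then have "c_sorting_word W S a [] w"
      using True by (auto simp: c_sorting_word_def reduced_subword_for_def reduced_word_for_def)
    then show ?thesis by (intro exI[of _ "[]"]) (simp add: nested_def)
  next
    case False
    obtain r where r: "r \<in> S" "simple_root r \<in> inv_roots w" using ex_descent wc False by blast
    then obtain s c where a: "a = s # c" using less.prems by (cases a) auto
    have sc: "distinct (s # c)" "set (s # c) \<subseteq> S" and s: "s \<in> S" using less.prems a by auto
    have rot: "distinct (c @ [s])" "set (c @ [s]) = S" using less.prems a by auto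
    have letters: "map (c_infinity a) (map Suc q) = map (c_infinity (c @ [s])) q" for q
      unfolding a by (simp add: c_infinity_rotate)
    have word0: "map (c_infinity a) (0 # map Suc q) = s # map (c_infinity (c @ [s])) q" for q
      using letters[of q] a c_infinity_0 by simp
    have tail: "reduced_subword_for W S (c @ [s]) q (s \<otimes> w)"
      if q: "reduced_subword_for W S a (0 # map Suc q) w" for q
    proof -
      have red: "reduced (s # map (c_infinity (c @ [s])) q)" "s \<otimes> val (map (c_infinity (c @ [s])) q) = w"
        using q unfolding reduced_subword_for_def reduced_word_for_iff word0 by simp_all
      then have "val (map (c_infinity (c @ [s])) q) = s \<otimes> w"
        using s reducedD(1)[OF reduced_ConsD(2)[OF red(1)]] by (metis S_cancel(1) val_closed)
      then show ?thesis
        using q reduced_ConsD(2)[OF red(1)]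
        by (simp add: reduced_subword_for_def reduced_word_for_iff sorted_wrt_map)
    qed
    have starts: "simple_root s \<in> inv_roots w"
      if q: "reduced_subword_for W S a (0 # map Suc q) w" for q
    proof -
      have red: "reduced (s # map (c_infinity (c @ [s])) q)" "s \<otimes> val (map (c_infinity (c @ [s])) q) = w"
        using q unfolding reduced_subword_for_def reduced_word_for_iff word0 by simp_all
      then show ?thesis
        using simple_root_inv_S_mult[OF s, of "val (map (c_infinity (c @ [s])) q)"] reduced_ConsD[OF red(1)]
          reducedD(1) by (metis val_closed)
    qed
    show ?thesis
    proof (cases "simple_root s \<in> inv_roots w")
      case True
      note d = descent_mult[OF s wc True]
      have l: "len w = Suc (len (s \<otimes> w))" using len_S_mult_descent s wc True by blast
      have "omega_sortable (c @ [s]) (s \<otimes> w)" using omega_sortable_left_mult[OF sc] less.prems(3) a True by simp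
      moreover have "length (takeWhile P (c @ [s])) \<le> length a" for P
        using length_takeWhile_le[of P "c @ [s]"] a by simp
      then have "len (s \<otimes> w) + length (takeWhile (\<lambda>t. simple_root t \<notin> inv_roots (s \<otimes> w)) (c @ [s]))
          + length (c @ [s]) * len (s \<otimes> w)
        < len w + length (takeWhile (\<lambda>t. simple_root t \<notin> inv_roots w) a) + length a * len w"
      proof -
        have "length (takeWhile (\<lambda>t. simple_root t \<notin> inv_roots (s \<otimes> w)) (c @ [s])) \<le> length a"
          by fact
        moreover have "length (c @ [s]) = length a" using a by simp
        ultimately show ?thesis unfolding l by (simp only: mult_Suc_right)
      qed
      ultimately obtain ps where ps: "c_sorting_word W S (c @ [s]) ps (s \<otimes> w)" "nested (length (c @ [s])) ps"
        using less.hyps rot by blast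
      have red: "reduced_subword_for W S (c @ [s]) ps (s \<otimes> w)"
        using ps(1) by (simp add: c_sorting_word_def)
      have "reduced_subword_for W S a (0 # map Suc ps) w"
      proof -
        have "reduced (map (c_infinity (c @ [s])) ps)" "val (map (c_infinity (c @ [s])) ps) = s \<otimes> w"
          using red by (simp_all add: reduced_subword_for_def reduced_word_for_iff)
        then have "reduced (s # map (c_infinity (c @ [s])) ps)" "val (s # map (c_infinity (c @ [s])) ps) = w"
          using s l d(3) by (auto simp: reduced_def)
        then show ?thesis
          using red unfolding reduced_subword_for_def reduced_word_for_iff word0
          by (simp add: sorted_wrt_map)
      qed
      moreover have "qs = 0 # map Suc ps \<or> (0 # map Suc ps, qs) \<in> lexord {(i, j). i < j}"
        if qs: "reduced_subword_for W S a qs w" for qs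
      proof -
        have "sorted_wrt (<) qs" using qs by (simp add: reduced_subword_for_def)
        then show ?thesis
        proof (cases rule: sorted_nat_list_cases)
          case (1 q)
          then show ?thesis
            using qs False by (cases q) (auto simp: reduced_subword_for_def reduced_word_for_def)
        next
          case (2 q)
          then have "q = ps \<or> (ps, q) \<in> lexord {(i, j). i < j}"
            using tail qs ps(1) by (auto simp: c_sorting_word_def)
          then show ?thesis using 2 lexord_map_Suc[of ps q] by auto
        qed
      qed
      ultimately have "c_sorting_word W S a (0 # map Suc ps) w" by (auto simp: c_sorting_word_def)
      moreover have "nested (length a) (0 # map Suc ps)"
        unfolding nested_def
      proof (intro allI impI)
        fix i assume i: "i + length a \<in> set (0 # map Suc ps)"
        show "i \<in> set (0 # map Suc ps)"
        proof (cases i)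
          case (Suc j)
          then have "j + length (c @ [s]) \<in> set ps" using i a by auto
          then show ?thesis using ps(2) Suc unfolding nested_def by auto
        qed simp
      qed
      ultimately show ?thesis by blast
    next
      case sw: False
      have oc: "omega_sortable c w" using omega_sortable_no_descent[OF sc] less.prems(3) a sw by simp
      then have "omega_sortable (c @ [s]) w" using omega_sortable_insert[of c "[]" w s] sc by simp
      moreover have "r \<in> set c" using r sw less.prems a by auto
      then have "takeWhile (\<lambda>t. simple_root t \<notin> inv_roots w) (c @ [s]) = takeWhile (\<lambda>t. simple_root t \<notin> inv_roots w) c"
        using r by (intro takeWhile_append1) auto
      then have "len w + length (takeWhile (\<lambda>t. simple_root t \<notin> inv_roots w) (c @ [s]))
          + length (c @ [s]) * len w
        < len w + length (takeWhile (\<lambda>t. simple_root t \<notin> inv_roots w) a) + length a * len w"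
        using a sw by simp
      ultimately obtain ps where ps: "c_sorting_word W S (c @ [s]) ps w" "nested (length (c @ [s])) ps"
        using less.hyps rot by blast
      have red: "reduced_subword_for W S (c @ [s]) ps w"
        using ps(1) by (simp add: c_sorting_word_def)
      have shift: "reduced_subword_for W S a (map Suc q) w \<longleftrightarrow> reduced_subword_for W S (c @ [s]) q w" for q
        using letters[of q] by (simp only: reduced_subword_for_def sorted_wrt_map Suc_less_eq)
      have "qs = map Suc ps \<or> (map Suc ps, qs) \<in> lexord {(i, j). i < j}"
        if qs: "reduced_subword_for W S a qs w" for qs
      proof -
        have "sorted_wrt (<) qs" using qs by (simp add: reduced_subword_for_def)
        then show ?thesis
        proof (cases rule: sorted_nat_list_cases)
          case (1 q)
          then have "q = ps \<or> (ps, q) \<in> lexord {(i, j). i < j}"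
            using shift qs ps(1) by (auto simp: c_sorting_word_def)
          then show ?thesis using 1 lexord_map_Suc[of ps q] by auto
        next
          case (2 q)
          then show ?thesis using starts qs sw by blast
        qed
      qed
      then have "c_sorting_word W S a (map Suc ps) w" using shift red by (simp add: c_sorting_word_def)
      moreover have "nested (length a) (map Suc ps)"
        unfolding nested_def
      proof (intro allI impI)
        fix i assume i: "i + length a \<in> set (map Suc ps)"
        show "i \<in> set (map Suc ps)"
        proof (cases i)
          case 0
          then have "length c \<in> set ps" using i a by auto
          then have "c_infinity (c @ [s]) (length c) \<in> set (map (c_infinity (c @ [s])) ps)" by simp
          then have "s \<in> set (map (c_infinity (c @ [s])) ps)" by (simp add: c_infinity_def)
          then obtain \<beta> where "\<beta> \<in> inv_roots w" "\<beta> s \<noteq> 0"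
            using reduced_letter_inv_root red unfolding reduced_subword_for_def reduced_word_for_iff by metis
          moreover have "s \<notin> set c" using sc by simp
          ultimately show ?thesis using omega_sortable_supported[OF oc] by (auto simp: supported_def)
        next
          case (Suc j)
          then have "j + length (c @ [s]) \<in> set ps" using i a by auto
          then show ?thesis using ps(2) Suc unfolding nested_def by auto
        qed
      qed
      ultimately show ?thesis by blast
    qed
  qed
qed

theorem c_sortable_iff_omega_sortable:
  assumes "distinct a" "set a = S"
  shows "c_sortable W S a w \<longleftrightarrow> omega_sortable a w"
proof
  assume "c_sortable W S a w"
  then obtain ps where ps: "c_sorting_word W S a ps w" "antimono (block_letters a ps)"
    by (auto simp: c_sortable_def)
  then have "sorted_wrt (<) ps" "reduced (map (c_infinity a) ps)" "val (map (c_infinity a) ps) = w"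
    by (simp_all add: c_sorting_word_def reduced_subword_for_def reduced_word_for_iff)
  then show "omega_sortable a w" using nested_word_omega_sortable[OF assms] ps(2) antimono_block_letters[OF assms(1)] by blast
next
  assume o: "omega_sortable a w"
  then show "c_sortable W S a w"
    using omega_sortable_sorting_word[OF assms o] omega_sortable_closed antimono_block_letters[OF assms(1)]
    by (auto simp: c_sortable_def)
qed

section \<open>The lattice of sortable elements\<close>

text \<open>At an element of maximal length every simple root is an inversion, and so is every nonnegative
  combination of them that is a root.\<close>

lemma ex_longest:
  assumes "finite (carrier W)"
  shows "\<exists>z\<in>carrier W. \<forall>w\<in>carrier W. inv_roots w \<subseteq> inv_roots z"
proof -
  have ne: "len ` carrier W \<noteq> {}" "finite (len ` carrier W)" using assms one_closed by blast+
  obtain z where z: "z \<in> carrier W" "len z = Max (len ` carrier W)" using Max_in[OF ne(2,1)] by auto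
  then have max: "len w \<le> len z" if "w \<in> carrier W" for w using Max_ge[OF ne(2)] that by simp
  have "simple_root s \<in> inv_roots z" if s: "s \<in> S" for s
    using len_S_mult_ascent[OF s z(1)] max[of "s \<otimes> z"] s z(1) S_carrier by fastforce
  moreover have "supported S \<beta>" if "\<beta> \<in> pos_roots" for \<beta>
    using root_outside pos_rootD(1) that by (auto simp: supported_def)
  ultimately have "pos_roots \<subseteq> inv_roots z" using inv_roots_supported[OF z(1), of S] by blast
  then show ?thesis using z inv_roots_pos by blast
qed

text \<open>A lower bound of maximal length absorbs its joins with the other lower bounds, which exist
  because \<open>x\<close> is an upper bound for them.\<close>

lemma ex_meet:
  assumes "x \<in> carrier W" "y \<in> carrier W"
  shows "\<exists>z. is_meet x y z"
proof -
  define L where "L = {u \<in> carrier W. inv_roots u \<subseteq> inv_roots x \<and> inv_roots u \<subseteq> inv_roots y}"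
  have bound: "len u < Suc (len x)" if "u \<in> L" for u
    using that card_mono[OF card_inv_roots(1)[OF assms(1)]] card_inv_roots(2) assms
    by (simp add: L_def less_Suc_eq_le) (metis)
  have "\<one> \<in> L" by (simp add: L_def)
  then obtain z where z: "z \<in> L" "\<forall>u. u \<in> L \<longrightarrow> len u \<le> len z"
    using ex_has_greatest_nat[of "\<lambda>u. u \<in> L" \<one> len "Suc (len x)"] bound by blast
  have "inv_roots u \<subseteq> inv_roots z" if u: "u \<in> L" for u
  proof -
    obtain j where j: "is_join u z j" using ex_join[OF assms(1), of u z] u z(1) by (auto simp: L_def)
    then have jL: "j \<in> L" using u z(1) assms by (simp add: L_def is_join_def)
    have "inv_roots z = inv_roots j"
    proof (rule card_seteq)
      show "finite (inv_roots j)" using card_inv_roots jL by (simp add: L_def)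
      show "inv_roots z \<subseteq> inv_roots j" using j by (simp add: is_join_def)
      show "card (inv_roots j) \<le> card (inv_roots z)"
        using z jL card_inv_roots(2) by (simp add: L_def)
    qed
    then show ?thesis using j by (simp add: is_join_def)
  qed
  then have "is_meet x y z" using z(1) unfolding is_meet_def L_def by blast
  then show ?thesis by blast
qed

lemma le_weak_order:
  "v \<in> carrier W \<Longrightarrow> w \<in> carrier W \<Longrightarrow> v \<sqsubseteq>\<^bsub>weak_order W S\<^esub> w \<longleftrightarrow> inv_roots v \<subseteq> inv_roots w"
  by (simp add: weak_order_def inversion_set_subset_iff)

lemma carrier_weak_order: "carrier (weak_order W S) = carrier W"
  and eq_weak_order: "(.=\<^bsub>weak_order W S\<^esub>) = (=)"
  by (simp_all add: weak_order_def)

lemma least_Upper_iff: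
  assumes "x \<in> carrier W" "y \<in> carrier W"
  shows "least (weak_order W S) z (Upper (weak_order W S) {x, y}) \<longleftrightarrow> is_join x y z"
proof -
  have "Upper (weak_order W S) {x, y} = {u \<in> carrier W. x \<sqsubseteq>\<^bsub>weak_order W S\<^esub> u \<and> y \<sqsubseteq>\<^bsub>weak_order W S\<^esub> u}"
    unfolding Upper_def carrier_weak_order using assms by blast
  also have "\<dots> = {u \<in> carrier W. inv_roots x \<subseteq> inv_roots u \<and> inv_roots y \<subseteq> inv_roots u}"
    using le_weak_order assms by blast
  finally have "least (weak_order W S) z (Upper (weak_order W S) {x, y}) \<longleftrightarrow>
      z \<in> carrier W \<and> inv_roots x \<subseteq> inv_roots z \<and> inv_roots y \<subseteq> inv_roots z \<and>
      (\<forall>u\<in>carrier W. inv_roots x \<subseteq> inv_roots u \<longrightarrow> inv_roots y \<subseteq> inv_roots u \<longrightarrow> z \<sqsubseteq>\<^bsub>weak_order W S\<^esub> u)"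
    unfolding least_def carrier_weak_order Ball_def mem_Collect_eq imp_conjL by auto
  then show ?thesis unfolding is_join_def by (simp add: le_weak_order cong: conj_cong)
qed

lemma greatest_Lower_iff:
  assumes "x \<in> carrier W" "y \<in> carrier W"
  shows "greatest (weak_order W S) z (Lower (weak_order W S) {x, y}) \<longleftrightarrow> is_meet x y z"
proof -
  have "Lower (weak_order W S) {x, y} = {u \<in> carrier W. u \<sqsubseteq>\<^bsub>weak_order W S\<^esub> x \<and> u \<sqsubseteq>\<^bsub>weak_order W S\<^esub> y}"
    unfolding Lower_def carrier_weak_order using assms by blast
  also have "\<dots> = {u \<in> carrier W. inv_roots u \<subseteq> inv_roots x \<and> inv_roots u \<subseteq> inv_roots y}"
    using le_weak_order assms by blast
  finally have "greatest (weak_order W S) z (Lower (weak_order W S) {x, y}) \<longleftrightarrow>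
      z \<in> carrier W \<and> inv_roots z \<subseteq> inv_roots x \<and> inv_roots z \<subseteq> inv_roots y \<and>
      (\<forall>u\<in>carrier W. inv_roots u \<subseteq> inv_roots x \<longrightarrow> inv_roots u \<subseteq> inv_roots y \<longrightarrow> u \<sqsubseteq>\<^bsub>weak_order W S\<^esub> z)"
    unfolding greatest_def carrier_weak_order Ball_def mem_Collect_eq imp_conjL by auto
  then show ?thesis unfolding is_meet_def by (simp add: le_weak_order cong: conj_cong)
qed

lemma weak_order_lattice:
  assumes "finite (carrier W)"
  shows "lattice (weak_order W S)"
proof -
  interpret partial_order "weak_order W S"
    by unfold_locales
      (auto simp: carrier_weak_order eq_weak_order le_weak_order intro: inv_roots_inj)
  show ?thesis
  proof unfold_locales
    fix x y assume "x \<in> carrier (weak_order W S)" "y \<in> carrier (weak_order W S)"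
    then have xy: "x \<in> carrier W" "y \<in> carrier W" by (simp_all add: carrier_weak_order)
    obtain z where "z \<in> carrier W" "\<forall>w\<in>carrier W. inv_roots w \<subseteq> inv_roots z" using ex_longest assms by blast
    then have "\<exists>j. is_join x y j" using ex_join[of z x y] xy by blast
    then show "\<exists>j. least (weak_order W S) j (Upper (weak_order W S) {x, y})"
      using least_Upper_iff[OF xy] by simp
    show "\<exists>j. greatest (weak_order W S) j (Lower (weak_order W S) {x, y})"
      using greatest_Lower_iff[OF xy] ex_meet[OF xy] by simp
  qed
qed

theorem sortable_sublattice:
  assumes "finite (carrier W)" "distinct a" "set a = S"
  shows "sublattice (weak_order W S) {w. c_sortable W S a w}"
proof -
  let ?L = "weak_order W S"
  have lat: "lattice ?L" by (rule weak_order_lattice) fact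
  have "x \<sqinter>\<^bsub>?L\<^esub> y \<in> {w. c_sortable W S a w} \<and> x \<squnion>\<^bsub>?L\<^esub> y \<in> {w. c_sortable W S a w}"
    if "c_sortable W S a x" "c_sortable W S a y" for x y
  proof -
    have o: "omega_sortable a x" "omega_sortable a y" using that c_sortable_iff_omega_sortable assms by auto
    then have xy: "x \<in> carrier W" "y \<in> carrier W" using omega_sortable_closed by auto
    then have L: "x \<in> carrier ?L" "y \<in> carrier ?L" by (simp_all add: carrier_weak_order)
    have ex: "\<exists>z. least ?L z (Upper ?L {x, y})" "\<exists>z. greatest ?L z (Lower ?L {x, y})"
      using upper_semilattice.sup_of_two_exists[OF lattice.axioms(1)[OF lat] L]
        lower_semilattice.inf_of_two_exists[OF lattice.axioms(2)[OF lat] L] by auto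
    have "least ?L (x \<squnion>\<^bsub>?L\<^esub> y) (Upper ?L {x, y})" "greatest ?L (x \<sqinter>\<^bsub>?L\<^esub> y) (Lower ?L {x, y})"
      using someI_ex[OF ex(1)] someI_ex[OF ex(2)] unfolding join_def meet_def sup_def inf_def by auto
    then have jm: "is_join x y (x \<squnion>\<^bsub>?L\<^esub> y)" "is_meet x y (x \<sqinter>\<^bsub>?L\<^esub> y)"
      using least_Upper_iff greatest_Lower_iff xy by auto
    have "set a \<subseteq> S" using assms by simp
    then have "omega_sortable a (x \<sqinter>\<^bsub>?L\<^esub> y)" "omega_sortable a (x \<squnion>\<^bsub>?L\<^esub> y)"
      using omega_sortable_meet[OF assms(2) _ o jm(2)] omega_sortable_join[OF assms(2) _ o jm(1)] by simp_all
    then show ?thesis unfolding mem_Collect_eq c_sortable_iff_omega_sortable[OF assms(2,3)] by blast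
  qed
  moreover have "{w. c_sortable W S a w} \<subseteq> carrier ?L"
    by (auto simp: c_sortable_def carrier_weak_order)
  ultimately show ?thesis using lat unfolding sublattice_def by blast
qed

end

theorem theorem1p2:
  fixes W :: "('a, 'b) monoid_scheme"
    and S :: "'a set"
    and m :: "'a \<Rightarrow> 'a \<Rightarrow> enat"
    and c :: 'a
    and a :: "'a list"
  assumes "coxeter_system W S m"
    and "finite (carrier W)"
    and "coxeter_element_word W S a c"
  shows "sublattice (weak_order W S) {w. c_sortable W S a w}"
proof -
  have "group W" using assms(1) by (simp add: coxeter_system_def presented_by_def)
  then interpret coxeter W S m by (intro coxeter.intro coxeter_axioms.intro assms(1))
  have "set a = S" "distinct a"
    using assms(3) by (auto simp: coxeter_element_word_def intro: card_distinct)
  then show ?thesis using sortable_sublattice assms(2) by blast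
qed

end
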